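(* Let $n\in\mathbb{N}$, let $T_n$ be the $n$-branching tree with graph distance $d$ and root $\emptyset$, and let $h(x)=d(x,\emptyset)=|x|$ for $x\in T_n$. Given $\beta\in\mathbb{R}$, there is a $(\sigma_h,\beta)$-KMS state on $\mathrm{C}^*_u(T_n)$ if and only if $\beta\ge\log(n)$. Moreover: (1) For $\beta>\log(n)$, there is a unique $(\sigma_h,\beta)$-KMS state $\varphi_\beta$ on $\mathrm{C}^*_u(T_n)$, given by $$\varphi_\beta([a_{x,y}])=\sum_{y\in T_n}a_{y,y}\big(e^{-\beta|y|}-ne^{-\beta(|y|+1)}\big)$$ for all $[a_{x,y}]\in\mathrm{C}^*_u(T_n)$. (2) For $\beta=\log(n)$, all $(\sigma_h,\beta)$-KMS states on $\mathrm{C}^*_u(T_n)$ vanish on $\mathcal{K}(\ell_2(T_n))$.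
   Context: $T_n$ is the set of all finite words (including the empty word $\emptyset$) over $\{1,\dots,n\}$, made into a graph by declaring two words adjacent iff one is obtained from the other by appending one letter on the right; $d$ is the shortest path metric and $|y|$ the length of $y$. $a_{x,y}=\langle a\delta_y,\delta_x\rangle$ and $\mathrm{C}^*_u(T_n)$ is the norm closure of the $^*$-algebra of operators $a$ on $\ell_2(T_n)$ with $\sup\{d(x,y):a_{x,y}\neq0\}<\infty$. $\sigma_{h,t}(a)=e^{it\bar h}ae^{-it\bar h}$ with $e^{it\bar h}\delta_x=e^{ith(x)}\delta_x$. A state $\varphi$ is $(\sigma_h,\beta)$-KMS if $\varphi(a\sigma_{h,i\beta}(b))=\varphi(ba)$ for all $a$ and all analytic $b$ (those for which $t\mapsto\sigma_{h,t}(b)$ extends to an entire function). *)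

theory Defs
  imports "HOL-Analysis.Analysis"
begin

type_synonym word = "nat list"

text \<open>Operators on l2(T_n) are represented by their matrices a x y = <a delta_y, delta_x>.\<close>
type_synonym mat = "word \<Rightarrow> word \<Rightarrow> complex"

definition Tn :: "nat \<Rightarrow> word set" where
  "Tn n = {x. set x \<subseteq> {1..n}}"

definition tree_adj :: "nat \<Rightarrow> (word \<times> word) set" where
  "tree_adj n = {(x, y). x \<in> Tn n \<and> y \<in> Tn n \<and>
      ((\<exists>c. y = x @ [c]) \<or> (\<exists>c. x = y @ [c]))}"

definition tdist :: "nat \<Rightarrow> word \<Rightarrow> word \<Rightarrow> nat" where
  "tdist n x y = (LEAST k. (x, y) \<in> tree_adj n ^^ k)"

definition ell2 :: "nat \<Rightarrow> (word \<Rightarrow> complex) set" where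
  "ell2 n = {f. (\<forall>x. x \<notin> Tn n \<longrightarrow> f x = 0) \<and> (\<lambda>x. (cmod (f x))^2) summable_on UNIV}"

definition ell2norm :: "(word \<Rightarrow> complex) \<Rightarrow> real" where
  "ell2norm f = sqrt (\<Sum>\<^sub>\<infinity>x. (cmod (f x))^2)"

definition mat_apply :: "mat \<Rightarrow> (word \<Rightarrow> complex) \<Rightarrow> (word \<Rightarrow> complex)" where
  "mat_apply a f = (\<lambda>x. \<Sum>\<^sub>\<infinity>y. a x y * f y)"

definition bounded_mat :: "nat \<Rightarrow> mat \<Rightarrow> bool" where
  "bounded_mat n a \<longleftrightarrow>
     (\<forall>x y. x \<notin> Tn n \<or> y \<notin> Tn n \<longrightarrow> a x y = 0) \<and>
     (\<exists>C. \<forall>f \<in> ell2 n. (\<forall>x. (\<lambda>y. a x y * f y) summable_on UNIV) \<and>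
                        mat_apply a f \<in> ell2 n \<and>
                        ell2norm (mat_apply a f) \<le> C * ell2norm f)"

definition opnorm :: "nat \<Rightarrow> mat \<Rightarrow> real" where
  "opnorm n a = Sup {ell2norm (mat_apply a f) | f. f \<in> ell2 n \<and> ell2norm f \<le> 1}"

definition mat_mult :: "mat \<Rightarrow> mat \<Rightarrow> mat" where
  "mat_mult a b = (\<lambda>x z. \<Sum>\<^sub>\<infinity>y. a x y * b y z)"

definition mat_adj :: "mat \<Rightarrow> mat" where
  "mat_adj a = (\<lambda>x y. cnj (a y x))"

definition mat_scale :: "complex \<Rightarrow> mat \<Rightarrow> mat" where
  "mat_scale c a = (\<lambda>x y. c * a x y)"

definition mat_add :: "mat \<Rightarrow> mat \<Rightarrow> mat" where
  "mat_add a b = (\<lambda>x y. a x y + b x y)"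

definition mat_diff :: "mat \<Rightarrow> mat \<Rightarrow> mat" where
  "mat_diff a b = (\<lambda>x y. a x y - b x y)"

definition mat_id :: "nat \<Rightarrow> mat" where
  "mat_id n = (\<lambda>x y. if x = y \<and> x \<in> Tn n then 1 else 0)"

definition finprop :: "nat \<Rightarrow> mat \<Rightarrow> bool" where
  "finprop n a \<longleftrightarrow> bounded_mat n a \<and> (\<exists>R. \<forall>x y. a x y \<noteq> 0 \<longrightarrow> tdist n x y \<le> R)"

text \<open>The uniform Roe algebra: norm closure of the finite propagation operators
  (which already form a *-algebra).\<close>
definition Cu :: "nat \<Rightarrow> mat set" where
  "Cu n = {a. bounded_mat n a \<and> (\<forall>e>0. \<exists>b. finprop n b \<and> opnorm n (mat_diff a b) < e)}"

text \<open>States on the unital C*-algebra Cu n (only values on Cu n matter).\<close>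
definition is_state :: "nat \<Rightarrow> (mat \<Rightarrow> complex) \<Rightarrow> bool" where
  "is_state n \<phi> \<longleftrightarrow>
     (\<forall>a \<in> Cu n. \<forall>b \<in> Cu n. \<phi> (mat_add a b) = \<phi> a + \<phi> b) \<and>
     (\<forall>a \<in> Cu n. \<forall>c. \<phi> (mat_scale c a) = c * \<phi> a) \<and>
     (\<forall>a \<in> Cu n. \<phi> (mat_mult (mat_adj a) a) \<in> \<real> \<and> Re (\<phi> (mat_mult (mat_adj a) a)) \<ge> 0) \<and>
     \<phi> (mat_id n) = 1"

text \<open>The dynamics sigma_{h,t}(a) = e^{i t h} a e^{-i t h}, for real t.\<close>
definition sigma :: "(word \<Rightarrow> real) \<Rightarrow> real \<Rightarrow> mat \<Rightarrow> mat" where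
  "sigma h t a = (\<lambda>x y. exp (\<i> * of_real t * of_real (h x - h y)) * a x y)"

definition entire_ext :: "nat \<Rightarrow> (word \<Rightarrow> real) \<Rightarrow> mat \<Rightarrow> (complex \<Rightarrow> mat) \<Rightarrow> bool" where
  "entire_ext n h b F \<longleftrightarrow>
     (\<forall>z. F z \<in> Cu n) \<and>
     (\<forall>t::real. F (of_real t) = sigma h t b) \<and>
     (\<forall>z. \<exists>D \<in> Cu n. ((\<lambda>w. opnorm n (mat_diff (mat_diff (F w) (F z)) (mat_scale (w - z) D)) / cmod (w - z)) \<longlongrightarrow> 0) (at z))"

text \<open>(sigma_h, beta)-KMS states: phi(a sigma_{i beta}(b)) = phi(b a) for all a and analytic b,
  where sigma_{i beta}(b) is the value at i beta of the entire extension.\<close>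
definition is_KMS :: "nat \<Rightarrow> (word \<Rightarrow> real) \<Rightarrow> real \<Rightarrow> (mat \<Rightarrow> complex) \<Rightarrow> bool" where
  "is_KMS n h \<beta> \<phi> \<longleftrightarrow> is_state n \<phi> \<and>
     (\<forall>a \<in> Cu n. \<forall>b \<in> Cu n. \<forall>F. entire_ext n h b F \<longrightarrow>
        \<phi> (mat_mult a (F (\<i> * of_real \<beta>))) = \<phi> (mat_mult b a))"

definition finite_rank :: "nat \<Rightarrow> mat \<Rightarrow> bool" where
  "finite_rank n a \<longleftrightarrow> bounded_mat n a \<and>
     (\<exists>k (u :: nat \<Rightarrow> word \<Rightarrow> complex). \<forall>f \<in> ell2 n.
        \<exists>c :: nat \<Rightarrow> complex. mat_apply a f = (\<lambda>x. \<Sum>i<k. c i * u i x))"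

definition compact_mat :: "nat \<Rightarrow> mat \<Rightarrow> bool" where
  "compact_mat n a \<longleftrightarrow> bounded_mat n a \<and> (\<forall>e>0. \<exists>b. finite_rank n b \<and> opnorm n (mat_diff a b) < e)"

end

theory Submission
  imports Defs "HOL-Complex_Analysis.Complex_Analysis"
begin

text \<open>
  Diagonal matrices are fixed by the dynamics, and the isometry \<open>crt n i\<close>, which sends
  \<open>\<delta>\<^sub>y\<close> to \<open>\<delta>\<close> of the word \<open>y\<close> followed by \<open>i\<close>, is an eigenvector of it. For a KMS state \<open>\<phi>\<close> this
  gives \<open>\<phi> (e\<^sub>x\<^sub>x) = exp (- \<beta> \<bar>x\<bar>) \<phi> (e)\<close> with \<open>e\<close> the projection onto the root, and, since the ranges of
  the \<open>n\<close> isometries and the root exhaust the tree, \<open>\<phi> (e) = 1 - n exp (- \<beta>)\<close>; hence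
  \<open>\<beta> \<ge> ln n\<close>. Moreover \<open>\<phi> (e\<^sub>x\<^sub>x a) = a\<^sub>x\<^sub>x \<phi> (e\<^sub>x\<^sub>x)\<close>. If \<open>\<beta> > ln n\<close>, the projections
  onto words of length less than \<open>N\<close> have values tending to 1, and the Cauchy-Schwarz inequality
  yields the formula for \<open>\<phi>\<close>. Conversely the formula defines a KMS state, because an entire orbit is
  determined entrywise by the identity theorem. At \<open>\<beta> = ln n\<close>, a cluster point of the states for
  \<open>\<beta> + 1/k\<close> is a KMS state, and \<open>\<phi>\<close> vanishes on every \<open>e\<^sub>x\<^sub>x\<close>, hence on compact matrices.
\<close>

section \<open>Square-summable functions\<close>

text \<open>\<open>is_state\<close> demands linearity, positivity and normalisation but no
  continuity, so \<phi> is never evaluated by passing to a norm limit: every remainder is estimated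
  through positivity. In Cauchy-Schwarz the matrix \<open>a\<close> contributes a constant, and only
  the value of the projection onto long words has to become small. For \<open>\<beta> > ln n\<close>
  the number \<open>1 - n exp (- \<beta>)\<close> is the reciprocal of the partition function of the
  tree, which has \<open>n ^ k\<close> words of length \<open>k\<close>. It is negative below the
  threshold and zero at it. There all weights of the formula vanish, so no Gibbs state is available,
  and existence has to come from compactness. Analyticity enters differently in the two directions.
  To derive consequences of the KMS condition it is enough to exhibit the orbits of homogeneous
  matrices. To verify the condition one must treat every analytic element, whose orbit is known only
  through its entries; the exponential factors of these entries are exactly what carries the weight
  of one word to that of another.\<close>

definition l2 :: "(word \<Rightarrow> complex) \<Rightarrow> bool" where
  "l2 f \<longleftrightarrow> (\<lambda>x. (cmod (f x))^2) summable_on UNIV"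

abbreviation fnorm :: "word set \<Rightarrow> (word \<Rightarrow> complex) \<Rightarrow> real" where
  "fnorm S f \<equiv> L2_set (\<lambda>x. cmod (f x)) S"

lemma ell2_iff: "f \<in> ell2 n \<longleftrightarrow> (\<forall>x. x \<notin> Tn n \<longrightarrow> f x = 0) \<and> l2 f"
  by (simp add: ell2_def l2_def)

lemma ell2norm_nonneg: "ell2norm f \<ge> 0"
  by (simp add: ell2norm_def infsum_nonneg)

lemma fnorm_le_ell2norm:
  assumes "l2 f" "finite S"
  shows "fnorm S f \<le> ell2norm f"
  unfolding L2_set_def ell2norm_def
  using assms by (intro real_sqrt_le_mono finite_sum_le_infsum) (auto simp: l2_def)

text \<open>Uniform bounds on finite sections yield square-summability and the norm estimate at
  once, so that most later convergence questions are settled here.\<close>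

lemma l2_bound:
  assumes "\<And>S. finite S \<Longrightarrow> fnorm S f \<le> C"
  shows "l2 f" "ell2norm f \<le> C"
proof -
  have C: "C \<ge> 0"
    using assms[of "{}"] by simp
  have le: "(\<Sum>x\<in>S. (cmod (f x))^2) \<le> C^2" if "finite S" for S
  proof -
    have "sqrt (\<Sum>x\<in>S. (cmod (f x))^2) \<le> C"
      using assms[OF that] by (simp add: L2_set_def)
    then show ?thesis
      using sqrt_le_D by blast
  qed
  show l2: "l2 f"
    unfolding l2_def
    by (rule nonneg_bdd_above_summable_on) (auto intro!: bdd_aboveI2[where M="C^2"] le)
  have "(\<Sum>\<^sub>\<infinity>x. (cmod (f x))^2) \<le> C^2"
    by (rule infsum_le_finite_sums) (use l2 le in \<open>auto simp: l2_def\<close>)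
  then show "ell2norm f \<le> C"
    using C by (simp add: ell2norm_def real_le_lsqrt)
qed

lemma fnorm_triangle: "fnorm S (\<lambda>x. f x + g x) \<le> fnorm S f + fnorm S g"
proof -
  have "fnorm S (\<lambda>x. f x + g x) \<le> L2_set (\<lambda>x. cmod (f x) + cmod (g x)) S"
    by (intro L2_set_mono norm_triangle_ineq norm_ge_zero)
  also have "\<dots> \<le> fnorm S f + fnorm S g"
    by (rule L2_set_triangle_ineq)
  finally show ?thesis .
qed

lemma fnorm_scale: "fnorm S (\<lambda>x. c * f x) = cmod c * fnorm S f"
  by (simp add: norm_mult L2_set_right_distrib)

lemma l2_add:
  assumes "l2 f" "l2 g"
  shows "l2 (\<lambda>x. f x + g x)" "ell2norm (\<lambda>x. f x + g x) \<le> ell2norm f + ell2norm g"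
proof -
  have "fnorm S (\<lambda>x. f x + g x) \<le> ell2norm f + ell2norm g" if "finite S" for S
    using fnorm_triangle[of f g S] fnorm_le_ell2norm[OF assms(1) that]
      fnorm_le_ell2norm[OF assms(2) that] by linarith
  then show "l2 (\<lambda>x. f x + g x)" "ell2norm (\<lambda>x. f x + g x) \<le> ell2norm f + ell2norm g"
    by - (rule l2_bound; blast)+
qed

lemma l2_scale:
  assumes "l2 f"
  shows "l2 (\<lambda>x. c * f x)" "ell2norm (\<lambda>x. c * f x) = cmod c * ell2norm f"
  using assms
  by (auto simp: l2_def ell2norm_def norm_mult power_mult_distrib infsum_cmult_right'
      real_sqrt_mult intro!: summable_on_cmult_right)

lemma l2_mono:
  assumes "l2 g" "\<And>x. cmod (f x) \<le> cmod (g x)"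
  shows "l2 f" "ell2norm f \<le> ell2norm g"
proof -
  have "fnorm S f \<le> ell2norm g" if "finite S" for S
    using L2_set_mono[of S "\<lambda>x. cmod (f x)" "\<lambda>x. cmod (g x)"] assms
      fnorm_le_ell2norm[OF assms(1) that] by force
  then show "l2 f" "ell2norm f \<le> ell2norm g"
    by - (rule l2_bound; blast)+
qed

lemma l2_finite:
  assumes "finite T" "\<And>x. x \<notin> T \<Longrightarrow> f x = 0"
  shows "l2 f" "ell2norm f = fnorm T f"
proof -
  have "(\<lambda>x. (cmod (f x))^2) summable_on UNIV \<longleftrightarrow> (\<lambda>x. (cmod (f x))^2) summable_on T"
    by (rule summable_on_cong_neutral) (use assms in auto)
  then show "l2 f"
    using assms by (simp add: l2_def)
  have "(\<Sum>\<^sub>\<infinity>x. (cmod (f x))^2) = (\<Sum>\<^sub>\<infinity>x\<in>T. (cmod (f x))^2)"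
    by (rule infsum_cong_neutral) (use assms in auto)
  then show "ell2norm f = fnorm T f"
    using assms by (simp add: ell2norm_def L2_set_def)
qed

lemma cmod_le_ell2norm: "l2 f \<Longrightarrow> cmod (f x) \<le> ell2norm f"
  using fnorm_le_ell2norm[of f "{x}"] by (simp add: L2_set_def)

lemma l2_cauchy_schwarz:
  assumes "l2 f" "l2 g"
  shows "(\<lambda>x. cmod (f x * g x)) summable_on UNIV"
    and "(\<Sum>\<^sub>\<infinity>x. cmod (f x * g x)) \<le> ell2norm f * ell2norm g"
proof -
  have le: "(\<Sum>x\<in>S. cmod (f x * g x)) \<le> ell2norm f * ell2norm g" if "finite S" for S
  proof -
    have "(\<Sum>x\<in>S. cmod (f x * g x)) \<le> fnorm S f * fnorm S g"
      using L2_set_mult_ineq[of "\<lambda>x. cmod (f x)" "\<lambda>x. cmod (g x)" S] by (simp add: norm_mult)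
    also have "\<dots> \<le> ell2norm f * ell2norm g"
      by (intro mult_mono fnorm_le_ell2norm assms that L2_set_nonneg ell2norm_nonneg)
    finally show ?thesis .
  qed
  show "(\<lambda>x. cmod (f x * g x)) summable_on UNIV"
    by (rule nonneg_bdd_above_summable_on)
       (auto intro!: bdd_aboveI2[where M="ell2norm f * ell2norm g"] le)
  then show "(\<Sum>\<^sub>\<infinity>x. cmod (f x * g x)) \<le> ell2norm f * ell2norm g"
    by (rule infsum_le_finite_sums) (use le in auto)
qed

lemma l2_mult_summable: "l2 f \<Longrightarrow> l2 g \<Longrightarrow> (\<lambda>x. f x * g x) summable_on UNIV"
  by (rule abs_summable_summable) (rule l2_cauchy_schwarz(1))

lemma infsum_finite_sum:
  fixes f :: "'a \<Rightarrow> 'b \<Rightarrow> complex"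
  assumes "finite T" "\<And>z. z \<in> T \<Longrightarrow> f z summable_on A"
  shows "(\<lambda>y. \<Sum>z\<in>T. f z y) summable_on A"
    and "(\<Sum>\<^sub>\<infinity>y\<in>A. \<Sum>z\<in>T. f z y) = (\<Sum>z\<in>T. infsum (f z) A)"
proof -
  have "(\<lambda>y. \<Sum>z\<in>T. f z y) summable_on A \<and>
      (\<Sum>\<^sub>\<infinity>y\<in>A. \<Sum>z\<in>T. f z y) = (\<Sum>z\<in>T. infsum (f z) A)"
    using assms by (induction T) (auto simp: infsum_add intro: summable_on_add)
  then show "(\<lambda>y. \<Sum>z\<in>T. f z y) summable_on A"
    "(\<Sum>\<^sub>\<infinity>y\<in>A. \<Sum>z\<in>T. f z y) = (\<Sum>z\<in>T. infsum (f z) A)"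
    by auto
qed

section \<open>Bounded matrices\<close>

definition supp :: "nat \<Rightarrow> mat \<Rightarrow> bool" where
  "supp n a \<longleftrightarrow> (\<forall>x y. x \<notin> Tn n \<or> y \<notin> Tn n \<longrightarrow> a x y = 0)"

text \<open>Boundedness by \<open>C\<close> tested on finite sections; no convergence question arises, and for
  matrices supported on \<open>Tn n\<close> it says exactly that the operator norm is at most \<open>C\<close>.\<close>
definition sbd :: "mat \<Rightarrow> real \<Rightarrow> bool" where
  "sbd a C \<longleftrightarrow> 0 \<le> C \<and> (\<forall>S T f. finite S \<longrightarrow> finite T \<longrightarrow>
     fnorm S (\<lambda>x. \<Sum>y\<in>T. a x y * f y) \<le> C * fnorm T f)"

lemma sbdI:
  assumes "0 \<le> C"
    "\<And>S T f. finite S \<Longrightarrow> finite T \<Longrightarrow> fnorm S (\<lambda>x. \<Sum>y\<in>T. a x y * f y) \<le> C * fnorm T f"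
  shows "sbd a C"
  using assms by (simp add: sbd_def)

lemma sbdD:
  "sbd a C \<Longrightarrow> finite S \<Longrightarrow> finite T \<Longrightarrow> fnorm S (\<lambda>x. \<Sum>y\<in>T. a x y * f y) \<le> C * fnorm T f"
  by (simp add: sbd_def)

lemma sbd_nonneg: "sbd a C \<Longrightarrow> 0 \<le> C"
  by (simp add: sbd_def)

lemma sbd_mono:
  assumes "sbd a C" "C \<le> D"
  shows "sbd a D"
proof (rule sbdI)
  show "0 \<le> D" using assms sbd_nonneg by fastforce
  fix S T f assume "finite (S::word set)" "finite (T::word set)"
  then have "fnorm S (\<lambda>x. \<Sum>y\<in>T. a x y * f y) \<le> C * fnorm T f"
    by (rule sbdD[OF assms(1)])
  also have "\<dots> \<le> D * fnorm T f"
    by (intro mult_right_mono assms L2_set_nonneg)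
  finally show "fnorm S (\<lambda>x. \<Sum>y\<in>T. a x y * f y) \<le> D * fnorm T f" .
qed

lemma sbd_add:
  assumes "sbd a C" "sbd b D"
  shows "sbd (mat_add a b) (C + D)"
proof (rule sbdI)
  show "0 \<le> C + D" using assms by (simp add: sbd_nonneg)
  fix S T f assume fin: "finite (S::word set)" "finite (T::word set)"
  have "fnorm S (\<lambda>x. \<Sum>y\<in>T. mat_add a b x y * f y)
     = fnorm S (\<lambda>x. (\<Sum>y\<in>T. a x y * f y) + (\<Sum>y\<in>T. b x y * f y))"
    by (simp add: mat_add_def distrib_right sum.distrib)
  also have "\<dots> \<le> fnorm S (\<lambda>x. \<Sum>y\<in>T. a x y * f y) + fnorm S (\<lambda>x. \<Sum>y\<in>T. b x y * f y)"
    by (rule fnorm_triangle)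
  also have "\<dots> \<le> (C + D) * fnorm T f"
    using sbdD[OF assms(1) fin] sbdD[OF assms(2) fin] by (simp add: distrib_right add_mono)
  finally show "fnorm S (\<lambda>x. \<Sum>y\<in>T. mat_add a b x y * f y) \<le> (C + D) * fnorm T f" .
qed

lemma sbd_scale:
  assumes "sbd a C"
  shows "sbd (mat_scale c a) (cmod c * C)"
proof (rule sbdI)
  show "0 \<le> cmod c * C" using assms by (simp add: sbd_nonneg)
  fix S T f assume fin: "finite (S::word set)" "finite (T::word set)"
  have "fnorm S (\<lambda>x. \<Sum>y\<in>T. mat_scale c a x y * f y) = cmod c * fnorm S (\<lambda>x. \<Sum>y\<in>T. a x y * f y)"
    by (simp add: mat_scale_def mult.assoc fnorm_scale flip: sum_distrib_left)
  then show "fnorm S (\<lambda>x. \<Sum>y\<in>T. mat_scale c a x y * f y) \<le> cmod c * C * fnorm T f"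
    using sbdD[OF assms fin, of f] by (simp add: mult.assoc mult_left_mono)
qed

lemma mat_diff_eq: "mat_diff a b = mat_add a (mat_scale (-1) b)"
  by (simp add: mat_diff_def mat_add_def mat_scale_def)

lemma sbd_diff: "sbd a C \<Longrightarrow> sbd b D \<Longrightarrow> sbd (mat_diff a b) (C + D)"
  using sbd_add[of a C "mat_scale (-1) b" D] sbd_scale[of b D "-1"] by (simp add: mat_diff_eq)

text \<open>Let \<open>v\<close> be the image of \<open>f\<close> under the adjoint. The square of
  its norm on \<open>S\<close> is the pairing of \<open>a v\<close> with \<open>f\<close> on
  \<open>T\<close>, hence at most \<open>C\<close> times the norms of \<open>v\<close> and
  \<open>f\<close>; divide by the norm of \<open>v\<close>. The bound for \<open>a\<close> is used
  with \<open>S\<close> and \<open>T\<close> exchanged.\<close>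

lemma sbd_adj:
  assumes "sbd a C"
  shows "sbd (mat_adj a) C"
proof (rule sbdI)
  show "0 \<le> C" using assms by (simp add: sbd_nonneg)
  fix S T and f :: "word \<Rightarrow> complex" assume fin: "finite (S::word set)" "finite (T::word set)"
  define v where "v = (\<lambda>x. \<Sum>y\<in>T. cnj (a y x) * f y)"
  define u where "u = (\<lambda>y. \<Sum>x\<in>S. a y x * v x)"
  have "(\<Sum>x\<in>S. cnj (v x) * v x) = (\<Sum>x\<in>S. \<Sum>y\<in>T. cnj (v x) * (cnj (a y x) * f y))"
    by (subst (2) v_def) (simp add: sum_distrib_left)
  also have "\<dots> = (\<Sum>y\<in>T. \<Sum>x\<in>S. cnj (v x) * (cnj (a y x) * f y))"
    by (rule sum.swap)
  also have "\<dots> = (\<Sum>y\<in>T. cnj (u y) * f y)"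
    by (simp add: u_def sum_distrib_left sum_distrib_right mult_ac)
  finally have eq: "(\<Sum>x\<in>S. cnj (v x) * v x) = (\<Sum>y\<in>T. cnj (u y) * f y)" .
  have "(\<Sum>x\<in>S. cnj (v x) * v x) = of_real ((fnorm S v)\<^sup>2)"
    by (simp add: L2_set_def sum_nonneg mult.commute flip: complex_norm_square)
  then have "(fnorm S v)\<^sup>2 = cmod (\<Sum>y\<in>T. cnj (u y) * f y)"
    using eq by (metis norm_of_real abs_of_nonneg zero_le_power2)
  also have "\<dots> \<le> (\<Sum>y\<in>T. \<bar>cmod (u y)\<bar> * \<bar>cmod (f y)\<bar>)"
    by (rule order_trans[OF norm_sum]) (simp add: norm_mult)
  also have "\<dots> \<le> fnorm T u * fnorm T f"
    by (rule L2_set_mult_ineq)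
  also have "\<dots> \<le> C * fnorm S v * fnorm T f"
    using sbdD[OF assms fin(2,1), of v] by (intro mult_right_mono L2_set_nonneg) (simp add: u_def)
  finally have *: "fnorm S v * fnorm S v \<le> fnorm S v * (C * fnorm T f)"
    by (simp add: power2_eq_square mult_ac)
  have "fnorm S v \<le> C * fnorm T f"
  proof (cases "fnorm S v = 0")
    case True
    then show ?thesis using sbd_nonneg[OF assms] by simp
  next
    case False
    then have "fnorm S v > 0" using L2_set_nonneg[of "\<lambda>x. cmod (v x)" S] by linarith
    then show ?thesis using * by simp
  qed
  then show "fnorm S (\<lambda>x. \<Sum>y\<in>T. mat_adj a x y * f y) \<le> C * fnorm T f"
    by (simp add: v_def mat_adj_def)
qed

text \<open>The test vector is the basis vector at \<open>y\<close>. Together with the version for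
  rows this makes the sums in \<open>mat_mult\<close> converge absolutely, by
  Cauchy-Schwarz.\<close>

lemma sbd_col:
  assumes "sbd a C"
  shows "l2 (\<lambda>x. a x y)" "ell2norm (\<lambda>x. a x y) \<le> C"
proof -
  have "fnorm S (\<lambda>x. a x y) \<le> C" if "finite S" for S
    using sbdD[OF assms that, of "{y}" "\<lambda>_. 1"] by simp
  then show "l2 (\<lambda>x. a x y)" "ell2norm (\<lambda>x. a x y) \<le> C"
    by - (rule l2_bound; blast)+
qed

lemma sbd_row:
  assumes "sbd a C"
  shows "l2 (a x)" "ell2norm (a x) \<le> C"
  using sbd_col[OF sbd_adj[OF assms], of x]
  by (simp_all add: mat_adj_def l2_def ell2norm_def)

lemma sbd_entry: "sbd a C \<Longrightarrow> cmod (a x y) \<le> C"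
  using sbd_row[of a C x] cmod_le_ell2norm[of "a x" y] by linarith

lemma sbd_apply:
  assumes a: "sbd a C" and f: "l2 f"
  shows "(\<lambda>y. a x y * f y) summable_on UNIV"
    and "l2 (mat_apply a f)" and "ell2norm (mat_apply a f) \<le> C * ell2norm f"
proof -
  show sm: "(\<lambda>y. a x y * f y) summable_on UNIV" for x
    by (rule l2_mult_summable[OF sbd_row(1)[OF a] f])
  \<comment> \<open>\<open>S\<close> stays fixed while \<open>T\<close> grows, so only finitely many
    row limits are taken at once.\<close>
  have "fnorm S (mat_apply a f) \<le> C * ell2norm f" if S: "finite S" for S
  proof (rule tendsto_upperbound)
    have "((\<lambda>T. \<Sum>y\<in>T. a x y * f y) \<longlongrightarrow> mat_apply a f x) (finite_subsets_at_top UNIV)" for x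
      unfolding mat_apply_def using has_sum_infsum[OF sm] by (simp add: has_sum_def)
    then show "((\<lambda>T. fnorm S (\<lambda>x. \<Sum>y\<in>T. a x y * f y)) \<longlongrightarrow> fnorm S (mat_apply a f))
        (finite_subsets_at_top UNIV)"
      unfolding L2_set_def by (intro tendsto_intros)
    show "\<forall>\<^sub>F T in finite_subsets_at_top UNIV.
        fnorm S (\<lambda>x. \<Sum>y\<in>T. a x y * f y) \<le> C * ell2norm f"
    proof (rule eventually_finite_subsets_at_top_weakI)
      fix T :: "word set" assume T: "finite T"
      have "fnorm S (\<lambda>x. \<Sum>y\<in>T. a x y * f y) \<le> C * fnorm T f"
        by (rule sbdD[OF a S T])
      also have "\<dots> \<le> C * ell2norm f"
        by (intro mult_left_mono fnorm_le_ell2norm f T sbd_nonneg[OF a])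
      finally show "fnorm S (\<lambda>x. \<Sum>y\<in>T. a x y * f y) \<le> C * ell2norm f" .
    qed
  qed simp
  then show "l2 (mat_apply a f)" "ell2norm (mat_apply a f) \<le> C * ell2norm f"
    by - (rule l2_bound; blast)+
qed

text \<open>Applying \<open>b\<close> to a finite vector gives a function \<open>h\<close> whose
  support may be infinite, so the estimate for \<open>a\<close> has to be the one for
  square-summable functions. The sums can be exchanged because \<open>T\<close> is finite.\<close>

lemma sbd_mult:
  assumes a: "sbd a C" and b: "sbd b D"
  shows "sbd (mat_mult a b) (C * D)"
proof (rule sbdI)
  show "0 \<le> C * D" using assms by (simp add: sbd_nonneg)
  fix S T f assume fin: "finite (S::word set)" "finite (T::word set)"
  define h where "h = (\<lambda>y. \<Sum>z\<in>T. b y z * f z)"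
  have "fnorm S' h \<le> D * fnorm T f" if "finite S'" for S'
    unfolding h_def by (rule sbdD[OF b that fin(2)])
  then have h: "l2 h" "ell2norm h \<le> D * fnorm T f"
    by - (rule l2_bound; blast)+
  have "(\<Sum>z\<in>T. mat_mult a b x z * f z) = mat_apply a h x" for x
  proof -
    have "(\<Sum>z\<in>T. mat_mult a b x z * f z) = (\<Sum>z\<in>T. \<Sum>\<^sub>\<infinity>y. a x y * b y z * f z)"
      unfolding mat_mult_def by (intro sum.cong refl infsum_cmult_left'[symmetric])
    also have "\<dots> = (\<Sum>\<^sub>\<infinity>y. \<Sum>z\<in>T. a x y * b y z * f z)"
      by (rule infsum_finite_sum(2)[symmetric, OF fin(2)])
         (intro summable_on_cmult_left l2_mult_summable sbd_row[OF a] sbd_col[OF b])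
    also have "\<dots> = mat_apply a h x"
      by (simp add: mat_apply_def h_def sum_distrib_left mult.assoc)
    finally show ?thesis .
  qed
  then have "fnorm S (\<lambda>x. \<Sum>z\<in>T. mat_mult a b x z * f z) = fnorm S (mat_apply a h)"
    by simp
  also have "\<dots> \<le> ell2norm (mat_apply a h)"
    by (intro fnorm_le_ell2norm sbd_apply(2)[OF a] h fin)
  also have "\<dots> \<le> C * ell2norm h"
    by (intro sbd_apply(3)[OF a] h)
  also have "\<dots> \<le> C * (D * fnorm T f)"
    by (intro mult_left_mono h sbd_nonneg[OF a])
  finally show "fnorm S (\<lambda>x. \<Sum>z\<in>T. mat_mult a b x z * f z) \<le> C * D * fnorm T f"
    by (simp add: mult.assoc)
qed

lemma mat_apply_finite:
  assumes "finite T" "\<And>y. y \<notin> T \<Longrightarrow> f y = 0"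
  shows "mat_apply a f x = (\<Sum>y\<in>T. a x y * f y)"
proof -
  have "mat_apply a f x = (\<Sum>\<^sub>\<infinity>y\<in>T. a x y * f y)"
    unfolding mat_apply_def by (rule infsum_cong_neutral) (use assms in auto)
  then show ?thesis using assms by simp
qed

lemma supp_apply:
  assumes "supp n a" "x \<notin> Tn n"
  shows "mat_apply a f x = 0"
  using assms by (simp add: mat_apply_def supp_def)

lemma mat_apply_scale: "mat_apply a (\<lambda>x. c * f x) = (\<lambda>x. c * mat_apply a f x)"
  by (simp add: mat_apply_def infsum_cmult_right' mult.left_commute)

section \<open>Finite-section bounds and the operator norm\<close>

lemma bounded_matI:
  assumes "supp n a" "sbd a C"
  shows "bounded_mat n a"
  unfolding bounded_mat_def
  using assms sbd_apply[OF assms(2)] supp_apply[OF assms(1)]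
  by (auto simp: supp_def ell2_iff intro!: exI[of _ C])

lemma opnorm_leI:
  assumes "\<And>f. f \<in> ell2 n \<Longrightarrow> ell2norm f \<le> 1 \<Longrightarrow> ell2norm (mat_apply a f) \<le> C"
  shows "opnorm n a \<le> C"
  unfolding opnorm_def
proof (rule cSup_least)
  \<comment> \<open>The zero function makes the set under \<open>Sup\<close> inhabited.\<close>
  have "ell2norm (\<lambda>x::word. 0) = 0"
    by (simp add: ell2norm_def)
  then have "ell2norm (mat_apply a (\<lambda>x. 0)) \<in> {ell2norm (mat_apply a f) |f. f \<in> ell2 n \<and> ell2norm f \<le> 1}"
    by (intro CollectI exI[of _ "\<lambda>x. 0"]) (auto simp: ell2_def)
  then show "{ell2norm (mat_apply a f) |f. f \<in> ell2 n \<and> ell2norm f \<le> 1} \<noteq> {}"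
    by blast
qed (use assms in auto)

lemma opnorm_le:
  assumes "sbd a C"
  shows "opnorm n a \<le> C"
proof (rule opnorm_leI)
  fix f assume f: "f \<in> ell2 n" "ell2norm f \<le> 1"
  then have "ell2norm (mat_apply a f) \<le> C * ell2norm f"
    using sbd_apply[OF assms] by (simp add: ell2_iff)
  also have "\<dots> \<le> C"
    using f sbd_nonneg[OF assms] mult_left_mono by fastforce
  finally show "ell2norm (mat_apply a f) \<le> C" .
qed

lemma bounded_mat_supp: "bounded_mat n a \<Longrightarrow> supp n a"
  by (simp add: bounded_mat_def supp_def)

lemma bounded_mat_opnorm_apply:
  assumes "bounded_mat n a" "f \<in> ell2 n"
  shows "ell2norm (mat_apply a f) \<le> opnorm n a * ell2norm f"
proof -
  obtain C where C: "\<And>f. f \<in> ell2 n \<Longrightarrow> mat_apply a f \<in> ell2 n \<and> ell2norm (mat_apply a f) \<le> C * ell2norm f"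
    using assms(1) unfolding bounded_mat_def by blast
  have bdd: "bdd_above {ell2norm (mat_apply a f) | f. f \<in> ell2 n \<and> ell2norm f \<le> 1}"
  proof (rule bdd_aboveI)
    fix r assume "r \<in> {ell2norm (mat_apply a f) | f. f \<in> ell2 n \<and> ell2norm f \<le> 1}"
    then obtain f where f: "r = ell2norm (mat_apply a f)" "f \<in> ell2 n" "ell2norm f \<le> 1" by auto
    have "r \<le> C * ell2norm f" using C f by simp
    \<comment> \<open>\<open>bounded_mat\<close> does not record the sign of
      \<open>C\<close>.\<close>
    also have "\<dots> \<le> \<bar>C\<bar> * ell2norm f" by (intro mult_right_mono ell2norm_nonneg) auto
    also have "\<dots> \<le> \<bar>C\<bar>" using f(3) by (simp add: mult_left_le)
    finally show "r \<le> \<bar>C\<bar>" .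
  qed
  show ?thesis
  proof (cases "ell2norm f = 0")
    case True
    then show ?thesis using C[OF assms(2)] by simp
  next
    case False
    then have pos: "ell2norm f > 0" using ell2norm_nonneg[of f] by linarith
    define c where "c = complex_of_real (1 / ell2norm f)"
    define g where "g = (\<lambda>x. c * f x)"
    have l2: "l2 f" using assms(2) by (simp add: ell2_iff)
    have g: "g \<in> ell2 n" "ell2norm g = 1"
      using assms(2) l2_scale[OF l2, of c] pos
      by (auto simp: ell2_iff g_def c_def simp del: of_real_divide)
    have "ell2norm (mat_apply a g) \<le> opnorm n a"
      unfolding opnorm_def by (rule cSup_upper) (use g bdd in auto)
    moreover have "ell2norm (mat_apply a g) = ell2norm (mat_apply a f) / ell2norm f"
    proof -
      have "l2 (mat_apply a f)" using C[OF assms(2)] by (simp add: ell2_iff)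
      from l2_scale(2)[OF this, of c] show ?thesis
        using pos by (simp add: g_def mat_apply_scale c_def del: of_real_divide)
    qed
    ultimately show ?thesis using pos by (simp add: field_simps)
  qed
qed

text \<open>The operator norm tests only functions living on the tree, so \<open>f\<close> is first
  cut down to \<open>T \<inter> Tn n\<close>; \<open>a\<close> vanishes on the discarded
  columns.\<close>

lemma bounded_mat_sbd:
  assumes "bounded_mat n a"
  shows "sbd a (opnorm n a)"
proof (rule sbdI)
  have *: "fnorm S (\<lambda>x. \<Sum>y\<in>T. a x y * f y) \<le> opnorm n a * fnorm T f \<and>
      fnorm S (\<lambda>x. \<Sum>y\<in>T. a x y * f y) \<le> opnorm n a * fnorm (T \<inter> Tn n) f"
    if fin: "finite S" "finite T" and op: "opnorm n a \<ge> 0" for S T f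
  proof -
    define f' where "f' = (\<lambda>x. if x \<in> T \<inter> Tn n then f x else 0)"
    have f': "l2 f'" "ell2norm f' = fnorm (T \<inter> Tn n) f'"
      by (rule l2_finite[of "T \<inter> Tn n"]; use fin in \<open>auto simp: f'_def\<close>)+
    have f'n: "f' \<in> ell2 n" using f' by (auto simp: ell2_iff f'_def)
    have "mat_apply a f' x = (\<Sum>y\<in>T. a x y * f y)" for x
      using mat_apply_finite[of T f' a x] fin bounded_mat_supp[OF assms]
      by (auto simp: f'_def supp_def intro!: sum.cong)
    then have "fnorm S (\<lambda>x. \<Sum>y\<in>T. a x y * f y) = fnorm S (mat_apply a f')"
      by simp
    also have "\<dots> \<le> ell2norm (mat_apply a f')"
      using assms f'n fin by (intro fnorm_le_ell2norm) (auto simp: bounded_mat_def ell2_iff)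
    also have "\<dots> \<le> opnorm n a * ell2norm f'"
      by (rule bounded_mat_opnorm_apply[OF assms f'n])
    also have "ell2norm f' = fnorm (T \<inter> Tn n) f"
      unfolding f'(2) by (rule L2_set_cong) (auto simp: f'_def)
    finally have A: "fnorm S (\<lambda>x. \<Sum>y\<in>T. a x y * f y) \<le> opnorm n a * fnorm (T \<inter> Tn n) f" .
    also have "\<dots> \<le> opnorm n a * fnorm T f"
      using fin op unfolding L2_set_def
      by (intro mult_left_mono real_sqrt_le_mono sum_mono2) auto
    finally show ?thesis using A by simp
  qed
  show nonneg: "0 \<le> opnorm n a"
  proof -
    \<comment> \<open>Nonnegativity, which allows \<open>T \<inter> Tn n\<close> to be enlarged to
      \<open>T\<close>, is read off from a unit vector; the root belongs to the tree for every
      \<open>n\<close>.\<close>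
    define f where "f = (\<lambda>x::word. if x = [] then 1 else (0::complex))"
    have f: "l2 f" "ell2norm f = fnorm {[]} f"
      by (rule l2_finite[of "{[]}"]; simp add: f_def)+
    have "f \<in> ell2 n" using f by (auto simp: ell2_iff f_def Tn_def)
    from bounded_mat_opnorm_apply[OF assms this]
    show ?thesis using f(2) ell2norm_nonneg[of "mat_apply a f"] by (simp add: f_def L2_set_def)
  qed
  show "fnorm S (\<lambda>x. \<Sum>y\<in>T. a x y * f y) \<le> opnorm n a * fnorm T f"
    if "finite S" "finite T" for S T f
    using *[OF that nonneg] by blast
qed

lemma bounded_mat_iff: "bounded_mat n a \<longleftrightarrow> supp n a \<and> (\<exists>C. sbd a C)"
  using bounded_matI bounded_mat_sbd bounded_mat_supp by blast

section \<open>Supports and algebraic identities of the matrix operations\<close>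

lemma supp_add: "supp n a \<Longrightarrow> supp n b \<Longrightarrow> supp n (mat_add a b)"
  and supp_scale: "supp n a \<Longrightarrow> supp n (mat_scale c a)"
  and supp_adj: "supp n a \<Longrightarrow> supp n (mat_adj a)"
  and supp_mult: "supp n a \<Longrightarrow> supp n b \<Longrightarrow> supp n (mat_mult a b)"
  by (auto simp: supp_def mat_add_def mat_scale_def mat_adj_def mat_mult_def)

lemma supp_diff: "supp n a \<Longrightarrow> supp n b \<Longrightarrow> supp n (mat_diff a b)"
  by (simp add: mat_diff_eq supp_add supp_scale)

lemma mat_mult_summable:
  "sbd a C \<Longrightarrow> sbd b D \<Longrightarrow> (\<lambda>y. a x y * b y z) summable_on UNIV"
  by (intro l2_mult_summable sbd_row sbd_col)

lemma mat_mult_scale_left: "mat_mult (mat_scale c a) b = mat_scale c (mat_mult a b)"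
  and mat_mult_scale_right: "mat_mult a (mat_scale c b) = mat_scale c (mat_mult a b)"
  by (simp_all add: mat_mult_def mat_scale_def infsum_cmult_right' mult.assoc mult.left_commute)

text \<open>Unlike the rules for scalars this one asks for bounded factors: a divergent
  \<open>infsum\<close> has value 0, which is compatible with scaling but not with addition.\<close>

lemma mat_mult_add_left:
  assumes "sbd a A" "sbd b B" "sbd c C"
  shows "mat_mult (mat_add a b) c = mat_add (mat_mult a c) (mat_mult b c)"
  using mat_mult_summable[OF assms(1,3)] mat_mult_summable[OF assms(2,3)]
  by (simp add: mat_mult_def mat_add_def distrib_right infsum_add)

lemma mat_mult_add_right:
  assumes "sbd a A" "sbd b B" "sbd c C"
  shows "mat_mult c (mat_add a b) = mat_add (mat_mult c a) (mat_mult c b)"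
  using mat_mult_summable[OF assms(3,1)] mat_mult_summable[OF assms(3,2)]
  by (simp add: mat_mult_def mat_add_def distrib_left infsum_add)

lemma mat_mult_diff_left:
  assumes "sbd a A" "sbd b B" "sbd c C"
  shows "mat_mult (mat_diff a b) c = mat_diff (mat_mult a c) (mat_mult b c)"
  using mat_mult_add_left[OF assms(1) sbd_scale[OF assms(2)] assms(3)]
  by (simp add: mat_diff_eq mat_mult_scale_left)

lemma mat_mult_diff_right:
  assumes "sbd a A" "sbd b B" "sbd c C"
  shows "mat_mult c (mat_diff a b) = mat_diff (mat_mult c a) (mat_mult c b)"
  using mat_mult_add_right[OF assms(1) sbd_scale[OF assms(2)] assms(3)]
  by (simp add: mat_diff_eq mat_mult_scale_right)

lemma mat_adj_adj [simp]: "mat_adj (mat_adj a) = a"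
  by (simp add: mat_adj_def)

lemma mat_adj_add: "mat_adj (mat_add a b) = mat_add (mat_adj a) (mat_adj b)"
  and mat_adj_scale: "mat_adj (mat_scale c a) = mat_scale (cnj c) (mat_adj a)"
  and mat_adj_diff: "mat_adj (mat_diff a b) = mat_diff (mat_adj a) (mat_adj b)"
  by (simp_all add: mat_adj_def mat_add_def mat_scale_def mat_diff_def)

section \<open>The graph distance\<close>

lemma tree_adj_relpow_sym: "(x, y) \<in> tree_adj n ^^ k \<Longrightarrow> (y, x) \<in> tree_adj n ^^ k"
proof (induction k arbitrary: x y)
  case (Suc k)
  then obtain z where z: "(x, z) \<in> tree_adj n ^^ k" "(z, y) \<in> tree_adj n" by auto
  then have "(y, z) \<in> tree_adj n" by (auto simp: tree_adj_def)
  with Suc.IH[OF z(1)] show ?case by (meson relpow_Suc_I2)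
qed auto

lemma tree_adj_to_root: "x \<in> Tn n \<Longrightarrow> ([], x) \<in> tree_adj n ^^ length x"
proof (induction x rule: rev_induct)
  case (snoc c x)
  then have "x \<in> Tn n" by (simp add: Tn_def)
  with snoc have "([], x) \<in> tree_adj n ^^ length x" "(x, x @ [c]) \<in> tree_adj n"
    by (auto simp: tree_adj_def)
  then show ?case by auto
qed simp

text \<open>The path through the root shows that \<open>LEAST\<close> ranges over a nonempty set, so
  the distance is attained by a path.\<close>

lemma tdist_relpow:
  assumes "x \<in> Tn n" "y \<in> Tn n"
  shows "(x, y) \<in> tree_adj n ^^ tdist n x y"
  unfolding tdist_def
proof (rule LeastI)
  show "(x, y) \<in> tree_adj n ^^ (length x + length y)"
    using tree_adj_to_root[OF assms(2)] tree_adj_relpow_sym[OF tree_adj_to_root[OF assms(1)]]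
    by (auto simp: relpow_add)
qed

lemma tdist_le: "(x, y) \<in> tree_adj n ^^ k \<Longrightarrow> tdist n x y \<le> k"
  unfolding tdist_def by (rule Least_le)

lemma tdist_self [simp]: "tdist n x x = 0"
  using tdist_le[of x x 0 n] by simp

lemma tdist_sym: "x \<in> Tn n \<Longrightarrow> y \<in> Tn n \<Longrightarrow> tdist n x y = tdist n y x"
  by (simp add: antisym tdist_le tdist_relpow tree_adj_relpow_sym)

lemma tdist_triangle:
  assumes "x \<in> Tn n" "y \<in> Tn n" "z \<in> Tn n"
  shows "tdist n x z \<le> tdist n x y + tdist n y z"
  using tdist_relpow[OF assms(1,2)] tdist_relpow[OF assms(2,3)]
  by (intro tdist_le) (auto simp: relpow_add)

section \<open>The uniform Roe algebra\<close>

lemma finpropI: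
  assumes "supp n a" "sbd a C" "\<And>x y. x \<in> Tn n \<Longrightarrow> y \<in> Tn n \<Longrightarrow> a x y \<noteq> 0 \<Longrightarrow> tdist n x y \<le> R"
  shows "finprop n a"
  unfolding finprop_def using bounded_matI[OF assms(1,2)] assms(1,3) by (meson supp_def)

lemma finprop_add:
  assumes "finprop n a" "finprop n b"
  shows "finprop n (mat_add a b)"
proof -
  obtain C D R S where "sbd a C" "sbd b D" and
    R: "\<And>x y. a x y \<noteq> 0 \<Longrightarrow> tdist n x y \<le> R" and S: "\<And>x y. b x y \<noteq> 0 \<Longrightarrow> tdist n x y \<le> S"
    using assms by (auto simp: finprop_def bounded_mat_iff)
  show ?thesis
  proof (rule finpropI)
    show "supp n (mat_add a b)" using assms by (intro supp_add) (auto simp: finprop_def bounded_mat_iff)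
    show "sbd (mat_add a b) (C + D)" by (rule sbd_add) fact+
    show "tdist n x y \<le> max R S" if "mat_add a b x y \<noteq> 0" for x y
    proof -
      have "a x y \<noteq> 0 \<or> b x y \<noteq> 0" using that by (auto simp: mat_add_def)
      then show ?thesis using R S by (meson le_max_iff_disj)
    qed
  qed
qed

lemma finprop_scale:
  assumes "finprop n a"
  shows "finprop n (mat_scale c a)"
proof -
  obtain C R where "sbd a C" and R: "\<And>x y. a x y \<noteq> 0 \<Longrightarrow> tdist n x y \<le> R"
    using assms by (auto simp: finprop_def bounded_mat_iff)
  then show ?thesis
    using assms by (intro finpropI[OF supp_scale sbd_scale])
      (auto simp: finprop_def bounded_mat_iff mat_scale_def)
qed

lemma finprop_adj:
  assumes "finprop n a"
  shows "finprop n (mat_adj a)"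
proof -
  obtain C R where "sbd a C" and R: "\<And>x y. a x y \<noteq> 0 \<Longrightarrow> tdist n x y \<le> R"
    using assms by (auto simp: finprop_def bounded_mat_iff)
  then show ?thesis
    using assms by (intro finpropI[OF supp_adj sbd_adj, where R=R])
      (auto simp: finprop_def bounded_mat_iff mat_adj_def, metis tdist_sym)
qed

lemma finprop_mult:
  assumes "finprop n a" "finprop n b"
  shows "finprop n (mat_mult a b)"
proof -
  obtain C D R S where C: "sbd a C" "sbd b D" and
    R: "\<And>x y. a x y \<noteq> 0 \<Longrightarrow> tdist n x y \<le> R" and S: "\<And>x y. b x y \<noteq> 0 \<Longrightarrow> tdist n x y \<le> S"
    using assms by (auto simp: finprop_def bounded_mat_iff)
  have supp: "supp n a" "supp n b" using assms by (auto simp: finprop_def bounded_mat_iff)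
  show ?thesis
  proof (rule finpropI[OF supp_mult[OF supp] sbd_mult[OF C]])
    fix x z assume x: "x \<in> Tn n" and z: "z \<in> Tn n" and nz: "mat_mult a b x z \<noteq> 0"
    \<comment> \<open>A nonzero infinite sum has a nonzero term, and its index is the intermediate
      word for the triangle inequality.\<close>
    have "\<exists>y. a x y * b y z \<noteq> 0"
    proof (rule ccontr)
      assume *: "\<not> ?thesis"
      have "mat_mult a b x z = infsum (\<lambda>y::word. 0) UNIV"
        unfolding mat_mult_def by (rule infsum_cong) (use * in blast)
      then show False using nz by simp
    qed
    then obtain y where y: "a x y \<noteq> 0" "b y z \<noteq> 0" by auto
    then have "y \<in> Tn n" using supp by (auto simp: supp_def)
    from tdist_triangle[OF x this z] R[OF y(1)] S[OF y(2)] show "tdist n x z \<le> R + S" by linarith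
  qed
qed

lemma Cu_supp: "a \<in> Cu n \<Longrightarrow> supp n a"
  by (simp add: Cu_def bounded_mat_iff)

lemma Cu_bounded_mat: "a \<in> Cu n \<Longrightarrow> bounded_mat n a"
  by (simp add: Cu_def)

lemma Cu_sbd: "a \<in> Cu n \<Longrightarrow> sbd a (opnorm n a)"
  by (simp add: Cu_bounded_mat bounded_mat_sbd)

lemma Cu_approx:
  assumes "a \<in> Cu n" "e > 0"
  obtains b where "finprop n b" "sbd (mat_diff a b) e"
proof -
  obtain b where b: "finprop n b" "opnorm n (mat_diff a b) < e"
    using assms by (auto simp: Cu_def)
  have "bounded_mat n (mat_diff a b)"
    using b(1) assms(1) unfolding finprop_def Cu_def bounded_mat_iff
    using sbd_diff supp_diff by blast
  then show ?thesis
    using that b bounded_mat_sbd sbd_mono by (meson less_imp_le)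
qed

text \<open>The strict inequality for \<open>opnorm\<close> in \<open>Cu\<close> may be replaced by
  a section bound with \<le>, since the tolerance is arbitrary; this is the reason for
  \<open>e / 2\<close>.\<close>

lemma CuI:
  assumes "supp n a" "sbd a C" "\<And>e. e > 0 \<Longrightarrow> \<exists>b. finprop n b \<and> sbd (mat_diff a b) e"
  shows "a \<in> Cu n"
proof -
  have "\<exists>b. finprop n b \<and> opnorm n (mat_diff a b) < e" if "e > 0" for e
  proof -
    obtain b where "finprop n b" "sbd (mat_diff a b) (e / 2)"
      using assms(3)[of "e / 2"] \<open>e > 0\<close> by auto
    then show ?thesis
      using opnorm_le[of "mat_diff a b" "e / 2" n] \<open>e > 0\<close> by (intro exI[of _ b]) auto
  qed
  then show ?thesis
    using bounded_matI[OF assms(1,2)] by (simp add: Cu_def)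
qed

lemma mat_diff_self: "mat_diff a a = (\<lambda>x y. 0)"
  by (simp add: mat_diff_def)

lemma sbd_zero: "0 \<le> C \<Longrightarrow> sbd (\<lambda>x y. 0) C"
  by (simp add: sbd_def L2_set_0')

lemma finprop_Cu: "finprop n a \<Longrightarrow> a \<in> Cu n"
  by (rule CuI[of n a "opnorm n a"])
     (auto simp: finprop_def bounded_mat_supp bounded_mat_sbd mat_diff_self sbd_zero intro!: exI[of _ a])

lemma Cu_closed:
  assumes "supp n a" "sbd a C" "\<And>e. e > 0 \<Longrightarrow> \<exists>b \<in> Cu n. sbd (mat_diff a b) e"
  shows "a \<in> Cu n"
proof (rule CuI[OF assms(1,2)])
  fix e :: real assume "e > 0"
  then obtain b where b: "b \<in> Cu n" "sbd (mat_diff a b) (e / 2)"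
    using assms(3)[of "e / 2"] by auto
  obtain c where c: "finprop n c" "sbd (mat_diff b c) (e / 2)"
    using Cu_approx[OF b(1), of "e / 2"] \<open>e > 0\<close> by auto
  have "mat_diff a c = mat_add (mat_diff a b) (mat_diff b c)"
    by (simp add: mat_diff_def mat_add_def fun_eq_iff)
  then show "\<exists>b. finprop n b \<and> sbd (mat_diff a b) e"
    using sbd_add[OF b(2) c(2)] c(1) by auto
qed

lemma Cu_add:
  assumes "a \<in> Cu n" "b \<in> Cu n"
  shows "mat_add a b \<in> Cu n"
proof (rule CuI[OF supp_add sbd_add[OF Cu_sbd Cu_sbd]])
  fix e :: real assume "e > 0"
  then have e: "e / 2 > 0" by simp
  obtain a' b' where "finprop n a'" "sbd (mat_diff a a') (e / 2)" "finprop n b'" "sbd (mat_diff b b') (e / 2)"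
    using Cu_approx[OF assms(1) e] Cu_approx[OF assms(2) e] by metis
  moreover have "mat_diff (mat_add a b) (mat_add a' b') = mat_add (mat_diff a a') (mat_diff b b')"
    by (simp add: mat_diff_def mat_add_def fun_eq_iff)
  ultimately show "\<exists>b'. finprop n b' \<and> sbd (mat_diff (mat_add a b) b') e"
    using finprop_add sbd_add[of "mat_diff a a'" "e / 2" "mat_diff b b'" "e / 2"]
    by (intro exI[of _ "mat_add a' b'"]) auto
qed (use assms Cu_supp in auto)

text \<open>Dividing the tolerance by \<open>c + 1\<close> instead of \<open>c\<close> spares the
  approximation arguments a case distinction on \<open>c = 0\<close>.\<close>

lemma mult_div_add_one_le:
  fixes c e :: real
  assumes "0 \<le> c" "0 < e"
  shows "c * (e / (c + 1)) \<le> e" "e / (c + 1) * c \<le> e"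
proof -
  have "c * (e / (c + 1)) \<le> (c + 1) * (e / (c + 1))"
    using assms by (intro mult_right_mono) auto
  then show "c * (e / (c + 1)) \<le> e" "e / (c + 1) * c \<le> e"
    using assms by (simp_all add: mult.commute)
qed

lemma Cu_scale:
  assumes "a \<in> Cu n"
  shows "mat_scale c a \<in> Cu n"
proof (rule CuI[OF supp_scale sbd_scale[OF Cu_sbd]])
  fix e :: real assume "e > 0"
  then have "e / (cmod c + 1) > 0" by (simp add: add_nonneg_pos)
  then obtain a' where a': "finprop n a'" "sbd (mat_diff a a') (e / (cmod c + 1))"
    using Cu_approx[OF assms] by metis
  have "mat_diff (mat_scale c a) (mat_scale c a') = mat_scale c (mat_diff a a')"
    by (simp add: mat_diff_def mat_scale_def algebra_simps)
  moreover have "cmod c * (e / (cmod c + 1)) \<le> e"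
    using \<open>e > 0\<close> by (intro mult_div_add_one_le) auto
  ultimately show "\<exists>b'. finprop n b' \<and> sbd (mat_diff (mat_scale c a) b') e"
    using finprop_scale[OF a'(1)] sbd_mono[OF sbd_scale[OF a'(2), of c]] by metis
qed (use assms Cu_supp in auto)

lemma Cu_diff: "a \<in> Cu n \<Longrightarrow> b \<in> Cu n \<Longrightarrow> mat_diff a b \<in> Cu n"
  by (simp add: mat_diff_eq Cu_add Cu_scale)

lemma Cu_adj:
  assumes "a \<in> Cu n"
  shows "mat_adj a \<in> Cu n"
proof (rule CuI[OF supp_adj sbd_adj[OF Cu_sbd]])
  fix e :: real assume "e > 0"
  then obtain a' where "finprop n a'" "sbd (mat_diff a a') e"
    using Cu_approx[OF assms] by metis
  then show "\<exists>b'. finprop n b' \<and> sbd (mat_diff (mat_adj a) b') e"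
    using finprop_adj sbd_adj by (metis mat_adj_diff)
qed (use assms Cu_supp in auto)

text \<open>The factors are approximated one at a time: for \<open>b'\<close> of finite propagation
  only \<open>a\<close> is replaced, and then \<open>Cu_closed\<close> handles a general
  \<open>b\<close>. Thus each error is multiplied by one fixed norm and no product of errors
  arises.\<close>

lemma Cu_mult:
  assumes a: "a \<in> Cu n" and b: "b \<in> Cu n"
  shows "mat_mult a b \<in> Cu n"
proof -
  have *: "mat_mult a b' \<in> Cu n" if b': "finprop n b'" for b'
  proof (rule CuI)
    have b'': "sbd b' (opnorm n b')" "supp n b'" using b' by (auto simp: finprop_def bounded_mat_sbd bounded_mat_supp)
    show "supp n (mat_mult a b')" using b'' a by (simp add: supp_mult Cu_supp)
    show "sbd (mat_mult a b') (opnorm n a * opnorm n b')" by (intro sbd_mult Cu_sbd a b'')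
    fix e :: real assume "e > 0"
    then have "e / (opnorm n b' + 1) > 0" using sbd_nonneg[OF b''(1)] by simp
    then obtain a' where a': "finprop n a'" "sbd (mat_diff a a') (e / (opnorm n b' + 1))"
      using Cu_approx[OF a] by metis
    have "mat_diff (mat_mult a b') (mat_mult a' b') = mat_mult (mat_diff a a') b'"
      using a'(1) by (intro mat_mult_diff_left[symmetric, OF Cu_sbd[OF a] bounded_mat_sbd[of n a'] b''(1)])
        (simp add: finprop_def)
    moreover have "(e / (opnorm n b' + 1)) * opnorm n b' \<le> e"
      using \<open>e > 0\<close> sbd_nonneg[OF b''(1)] by (intro mult_div_add_one_le)
    ultimately show "\<exists>c. finprop n c \<and> sbd (mat_diff (mat_mult a b') c) e"
      using finprop_mult[OF a'(1) b'] sbd_mono[OF sbd_mult[OF a'(2) b''(1)]] by metis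
  qed
  show ?thesis
  proof (rule Cu_closed[OF supp_mult sbd_mult[OF Cu_sbd Cu_sbd]])
    fix e :: real assume "e > 0"
    have nn: "opnorm n a \<ge> 0" using sbd_nonneg[OF Cu_sbd[OF a]] .
    then have "e / (opnorm n a + 1) > 0" using \<open>e > 0\<close> by simp
    then obtain b' where b': "finprop n b'" "sbd (mat_diff b b') (e / (opnorm n a + 1))"
      using Cu_approx[OF b] by metis
    have "mat_diff (mat_mult a b) (mat_mult a b') = mat_mult a (mat_diff b b')"
      using b'(1) by (intro mat_mult_diff_right[symmetric, OF Cu_sbd[OF b] bounded_mat_sbd[of n b'] Cu_sbd[OF a]])
        (simp add: finprop_def)
    moreover have "opnorm n a * (e / (opnorm n a + 1)) \<le> e"
      using \<open>e > 0\<close> nn by (intro mult_div_add_one_le)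
    ultimately show "\<exists>c\<in>Cu n. sbd (mat_diff (mat_mult a b) c) e"
      using *[OF b'(1)] sbd_mono[OF sbd_mult[OF Cu_sbd[OF a] b'(2)]] by metis
  qed (use a b Cu_supp in auto)
qed

section \<open>Diagonal matrices and the creation isometries\<close>

definition dg :: "nat \<Rightarrow> (word \<Rightarrow> complex) \<Rightarrow> mat" where
  "dg n g = (\<lambda>x y. if x = y \<and> x \<in> Tn n then g x else 0)"

lemma mat_id_dg: "mat_id n = dg n (\<lambda>_. 1)"
  by (simp add: mat_id_def dg_def)

lemma infsum_delta:
  "(\<Sum>\<^sub>\<infinity>y. if y = x then f y else 0) = (f x :: complex)"
  using infsum_cong_neutral[of "{x}" UNIV "\<lambda>y. if y = x then f y else 0"
      "\<lambda>y. if y = x then f y else 0"] by simp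

lemma dg_mult:
  assumes "supp n a"
  shows "mat_mult (dg n g) a = (\<lambda>x y. g x * a x y)"
proof (intro ext)
  fix x z
  have "mat_mult (dg n g) a x z = (\<Sum>\<^sub>\<infinity>y. if y = x then g y * a y z else 0)"
    unfolding mat_mult_def dg_def using assms by (intro infsum_cong) (auto simp: supp_def)
  then show "mat_mult (dg n g) a x z = g x * a x z"
    by (simp add: infsum_delta)
qed

lemma mult_dg:
  assumes "supp n a"
  shows "mat_mult a (dg n g) = (\<lambda>x y. a x y * g y)"
proof (intro ext)
  fix x z
  have "mat_mult a (dg n g) x z = (\<Sum>\<^sub>\<infinity>y. if y = z then a x y * g y else 0)"
    unfolding mat_mult_def dg_def using assms by (intro infsum_cong) (auto simp: supp_def)
  then show "mat_mult a (dg n g) x z = a x z * g z"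
    by (simp add: infsum_delta)
qed

lemma supp_dg: "supp n (dg n g)"
  by (auto simp: supp_def dg_def)

lemma dg_dg: "mat_mult (dg n f) (dg n g) = dg n (\<lambda>x. f x * g x)"
  by (simp add: dg_mult supp_dg) (auto simp: dg_def fun_eq_iff)

lemma dg_adj: "mat_adj (dg n g) = dg n (\<lambda>x. cnj (g x))"
  by (auto simp: mat_adj_def dg_def fun_eq_iff)

lemma sbd_dg:
  assumes "\<And>x. cmod (g x) \<le> C"
  shows "sbd (dg n g) C"
proof (rule sbdI)
  show C: "0 \<le> C" using assms[of "[]"] norm_ge_zero order_trans by blast
  fix S T and f :: "word \<Rightarrow> complex" assume fin: "finite (S::word set)" "finite (T::word set)"
  have *: "(\<Sum>y\<in>T. dg n g x y * f y) = (if x \<in> T \<and> x \<in> Tn n then g x * f x else 0)" for x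
  proof -
    have "(\<Sum>y\<in>T. dg n g x y * f y) = (\<Sum>y\<in>T. if x = y then (if x \<in> Tn n then g x * f x else 0) else 0)"
      by (intro sum.cong) (auto simp: dg_def)
    then show ?thesis using fin by simp
  qed
  have "(\<Sum>x\<in>S. (cmod (\<Sum>y\<in>T. dg n g x y * f y))\<^sup>2) \<le> (\<Sum>x\<in>S. if x \<in> T then (C * cmod (f x))\<^sup>2 else 0)"
    unfolding * by (intro sum_mono) (auto simp: norm_mult intro!: power_mono mult_right_mono assms)
  also have "\<dots> \<le> (\<Sum>x\<in>S \<union> T. if x \<in> T then (C * cmod (f x))\<^sup>2 else 0)"
    using fin by (intro sum_mono2) auto
  also have "\<dots> = (\<Sum>x\<in>T. (C * cmod (f x))\<^sup>2)"
    using fin by (simp add: sum.If_cases Int_absorb1)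
  finally have "fnorm S (\<lambda>x. \<Sum>y\<in>T. dg n g x y * f y) \<le> L2_set (\<lambda>x. C * cmod (f x)) T"
    unfolding L2_set_def by (rule real_sqrt_le_mono)
  then show "fnorm S (\<lambda>x. \<Sum>y\<in>T. dg n g x y * f y) \<le> C * fnorm T f"
    using C by (simp add: L2_set_right_distrib)
qed

lemma dg_Cu: "(\<And>x. cmod (g x) \<le> C) \<Longrightarrow> dg n g \<in> Cu n"
  by (intro finprop_Cu finpropI[OF supp_dg sbd_dg, of g C n 0]) (auto simp: dg_def split: if_splits)

definition crt :: "nat \<Rightarrow> nat \<Rightarrow> mat" where
  "crt n i = (\<lambda>x y. if y \<in> Tn n \<and> x = y @ [i] then 1 else 0)"

text \<open>Each row has at most one nonzero entry, in the column of the parent word, and appending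
  \<open>i\<close> is injective, so the squares in the norm are only relabelled.\<close>

lemma sbd_crt: "sbd (crt n i) 1"
proof (rule sbdI)
  fix S T and f :: "word \<Rightarrow> complex" assume fin: "finite (S::word set)" "finite (T::word set)"
  let ?k = "\<lambda>y. y @ [i]"
  define U where "U = ?k ` (T \<inter> Tn n)"
  have *: "(\<Sum>y\<in>T. crt n i x y * f y) = (if x \<in> U then f (butlast x) else 0)" for x
  proof -
    have "(\<Sum>y\<in>T. crt n i x y * f y) = (\<Sum>y\<in>T. if y = butlast x then (if x \<in> U then f (butlast x) else 0) else 0)"
      by (intro sum.cong) (auto simp: crt_def U_def)
    also have "\<dots> = (if x \<in> U then f (butlast x) else 0)"
      using fin by (auto simp: U_def)
    finally show ?thesis .
  qed
  have "(\<Sum>x\<in>S. (cmod (\<Sum>y\<in>T. crt n i x y * f y))\<^sup>2) = (\<Sum>x\<in>S \<inter> U. (cmod (f (butlast x)))\<^sup>2)"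
    unfolding * using fin by (auto simp: sum.inter_restrict intro!: sum.cong)
  also have "\<dots> \<le> (\<Sum>x\<in>U. (cmod (f (butlast x)))\<^sup>2)"
    using fin by (intro sum_mono2) (auto simp: U_def)
  also have "\<dots> = (\<Sum>y\<in>T \<inter> Tn n. (cmod (f y))\<^sup>2)"
    unfolding U_def by (subst sum.reindex) (auto simp: inj_on_def)
  also have "\<dots> \<le> (\<Sum>y\<in>T. (cmod (f y))\<^sup>2)"
    using fin by (intro sum_mono2) auto
  finally show "fnorm S (\<lambda>x. \<Sum>y\<in>T. crt n i x y * f y) \<le> 1 * fnorm T f"
    by (simp add: L2_set_def)
qed simp

lemma supp_crt: "i \<in> {1..n} \<Longrightarrow> supp n (crt n i)"
  by (auto simp: supp_def crt_def Tn_def)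

lemma crt_Cu:
  assumes "i \<in> {1..n}"
  shows "crt n i \<in> Cu n"
proof (intro finprop_Cu finpropI[OF supp_crt[OF assms] sbd_crt])
  fix x y assume "x \<in> Tn n" "y \<in> Tn n" "crt n i x y \<noteq> 0"
  then have "(x, y) \<in> tree_adj n ^^ 1"
    by (auto simp: tree_adj_def crt_def split: if_splits)
  then show "tdist n x y \<le> 1" by (rule tdist_le)
qed

lemma mult_crt:
  "mat_mult a (crt n i) = (\<lambda>x y. if y \<in> Tn n then a x (y @ [i]) else 0)"
proof (intro ext)
  fix x z
  have "mat_mult a (crt n i) x z = (\<Sum>\<^sub>\<infinity>y. if y = z @ [i] then (if z \<in> Tn n then a x y else 0) else 0)"
    unfolding mat_mult_def crt_def by (intro infsum_cong) auto
  then show "mat_mult a (crt n i) x z = (if z \<in> Tn n then a x (z @ [i]) else 0)"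
    by (simp add: infsum_delta)
qed

lemma crt_mult:
  assumes "supp n a"
  shows "mat_mult (crt n i) a = (\<lambda>x y. if x \<noteq> [] \<and> last x = i then a (butlast x) y else 0)"
proof (intro ext)
  fix x z
  have "crt n i x y * a y z = (if y = butlast x then (if x \<noteq> [] \<and> last x = i then a y z else 0) else 0)" for y
    using assms by (cases x rule: rev_cases) (auto simp: supp_def crt_def)
  then have "mat_mult (crt n i) a x z = (\<Sum>\<^sub>\<infinity>y. if y = butlast x then (if x \<noteq> [] \<and> last x = i then a y z else 0) else 0)"
    by (simp only: mat_mult_def)
  then show "mat_mult (crt n i) a x z = (if x \<noteq> [] \<and> last x = i then a (butlast x) z else 0)"
    by (simp add: infsum_delta)
qed

section \<open>States\<close>

lemma
  assumes "is_state n \<phi>"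
  shows state_add: "a \<in> Cu n \<Longrightarrow> b \<in> Cu n \<Longrightarrow> \<phi> (mat_add a b) = \<phi> a + \<phi> b"
    and state_scale: "a \<in> Cu n \<Longrightarrow> \<phi> (mat_scale c a) = c * \<phi> a"
    and state_real: "a \<in> Cu n \<Longrightarrow> \<phi> (mat_mult (mat_adj a) a) \<in> \<real>"
    and state_nonneg: "a \<in> Cu n \<Longrightarrow> 0 \<le> Re (\<phi> (mat_mult (mat_adj a) a))"
    and state_id: "\<phi> (mat_id n) = 1"
  using assms by (auto simp: is_state_def)

text \<open>The four numbers stand for the values of \<phi> in the expansion for
  \<open>a + c b\<close>. A state is not assumed to be hermitian; \<open>s = cnj r\<close> is
  extracted from reality at \<open>c = 0\<close>, \<open>c = 1\<close> and
  \<open>c = \<i>\<close>.\<close>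

lemma sesquilinear_cauchy_schwarz:
  fixes p q r s :: complex
  assumes "\<And>c. p + c * s + cnj c * r + c * cnj c * q \<in> \<real>"
    and "\<And>c. 0 \<le> Re (p + c * s + cnj c * r + c * cnj c * q)"
    and q: "q \<in> \<real>" "0 \<le> Re q"
  shows "(cmod r)\<^sup>2 \<le> Re p * Re q"
proof -
  have im: "Im (p + c * s + cnj c * r + c * cnj c * q) = 0" for c
    using assms(1) by (simp add: complex_is_Real_iff)
  have imq: "Im q = 0" using q by (simp add: complex_is_Real_iff)
  have "Im p = 0" using im[of 0] by simp
  have "Im s + Im r = 0" using im[of 1] imq \<open>Im p = 0\<close> by simp
  moreover have "Re s - Re r = 0" using im[of \<i>] imq \<open>Im p = 0\<close> by simp
  ultimately have s: "s = cnj r" by (simp add: complex_eq_iff)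
  have quad: "0 \<le> Re p - 2 * t * (cmod r)\<^sup>2 + t\<^sup>2 * (cmod r)\<^sup>2 * Re q" for t
  proof -
    \<comment> \<open>The phase of \<open>r\<close> makes both cross terms real and equal, which
      leaves a quadratic in the real parameter \<open>t\<close>.\<close>
    define c where "c = - of_real t * r"
    have 1: "c * s = of_real (- t * (cmod r)\<^sup>2)"
      unfolding c_def s by (simp add: mult.assoc complex_norm_square del: of_real_power)
    have 2: "cnj c * r = of_real (- t * (cmod r)\<^sup>2)"
      unfolding c_def by (simp add: mult.commute mult.left_commute complex_norm_square del: of_real_power)
    have 3: "c * cnj c = of_real (t\<^sup>2 * (cmod r)\<^sup>2)"
      unfolding c_def by (simp add: mult_ac power2_eq_square flip: complex_norm_square)
    have "Re (p + c * s + cnj c * r + c * cnj c * q) = Re p - 2 * t * (cmod r)\<^sup>2 + t\<^sup>2 * (cmod r)\<^sup>2 * Re q"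
      unfolding 1 2 3 by simp
    then show ?thesis using assms(2)[of c] by simp
  qed
  show ?thesis
  proof (cases "Re q = 0")
    case True
    have "(cmod r)\<^sup>2 = 0"
    proof (rule ccontr)
      assume "(cmod r)\<^sup>2 \<noteq> 0"
      then have "(cmod r)\<^sup>2 > 0" by simp
      \<comment> \<open>With \<open>Re q = 0\<close> the expression is affine in \<open>t\<close>,
        and this \<open>t\<close> gives it the value -1.\<close>
      then show False
        using quad[of "(Re p + 1) / (2 * (cmod r)\<^sup>2)"] True by (simp add: field_simps)
    qed
    then show ?thesis using True by simp
  next
    case False
    then have "Re q > 0" using q by simp
    \<comment> \<open>\<open>1 / Re q\<close> is a minimiser of the quadratic.\<close>
    then show ?thesis
      using quad[of "1 / Re q"] by (simp add: field_simps power2_eq_square)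
  qed
qed

lemma mat_scale_add: "mat_scale c (mat_add a b) = mat_add (mat_scale c a) (mat_scale c b)"
  by (simp add: mat_scale_def mat_add_def distrib_left)

lemma state_cauchy_schwarz:
  assumes st: "is_state n \<phi>" and a: "a \<in> Cu n" and b: "b \<in> Cu n"
  shows "(cmod (\<phi> (mat_mult (mat_adj b) a)))\<^sup>2
    \<le> Re (\<phi> (mat_mult (mat_adj a) a)) * Re (\<phi> (mat_mult (mat_adj b) b))"
proof (rule sesquilinear_cauchy_schwarz)
  let ?m = "\<lambda>a b. mat_mult (mat_adj a) b"
  have cl: "?m a b \<in> Cu n" "?m b a \<in> Cu n" "?m a a \<in> Cu n" "?m b b \<in> Cu n"
    using a b by (simp_all add: Cu_mult Cu_adj)
  have eq: "\<phi> (?m (mat_add a (mat_scale c b)) (mat_add a (mat_scale c b)))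
      = \<phi> (?m a a) + c * \<phi> (?m a b) + cnj c * \<phi> (?m b a) + c * cnj c * \<phi> (?m b b)" for c
  proof -
    note bd = Cu_sbd[OF a] Cu_sbd[OF b] Cu_sbd[OF Cu_scale[OF b, of c]] Cu_sbd[OF Cu_adj[OF a]]
      Cu_sbd[OF Cu_adj[OF b]] Cu_sbd[OF Cu_scale[OF Cu_adj[OF b], of "cnj c"]]
    have "?m (mat_add a (mat_scale c b)) (mat_add a (mat_scale c b))
      = mat_add (mat_add (?m a a) (mat_scale c (?m a b)))
          (mat_add (mat_scale (cnj c) (?m b a)) (mat_scale (cnj c) (mat_scale c (?m b b))))"
      unfolding mat_adj_add mat_adj_scale
      by (subst mat_mult_add_left[OF bd(4,6) sbd_add[OF bd(1,3)]])
         (simp add: mat_mult_add_right[OF bd(1,3,4)] mat_mult_add_right[OF bd(1,3,5)]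
           mat_mult_scale_left mat_mult_scale_right mat_scale_add)
    then show ?thesis
      using cl by (simp add: state_add[OF st] state_scale[OF st] Cu_add Cu_scale)
  qed
  show "\<phi> (?m a a) + c * \<phi> (?m a b) + cnj c * \<phi> (?m b a) + c * cnj c * \<phi> (?m b b) \<in> \<real>" for c
    using state_real[OF st, of "mat_add a (mat_scale c b)"] a b by (simp add: eq Cu_add Cu_scale)
  show "0 \<le> Re (\<phi> (?m a a) + c * \<phi> (?m a b) + cnj c * \<phi> (?m b a) + c * cnj c * \<phi> (?m b b))" for c
    using state_nonneg[OF st, of "mat_add a (mat_scale c b)"] a b by (simp only: eq Cu_add Cu_scale)
qed (use st b state_real state_nonneg in auto)

section \<open>Projections onto sets of words\<close>

definition pr :: "nat \<Rightarrow> word set \<Rightarrow> mat" where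
  "pr n A = dg n (\<lambda>x. if x \<in> A then 1 else 0)"

lemma pr_Cu [simp]: "pr n A \<in> Cu n"
  unfolding pr_def by (rule dg_Cu[of _ 1]) auto

lemma pr_adj [simp]: "mat_adj (pr n A) = pr n A"
  by (simp add: pr_def dg_adj if_distrib cong: if_cong)

lemma pr_pr [simp]: "mat_mult (pr n A) (pr n A) = pr n A"
  unfolding pr_def dg_dg by (rule arg_cong[of _ _ "dg n"]) auto

lemma pr_mult: "supp n a \<Longrightarrow> mat_mult (pr n A) a = (\<lambda>x y. if x \<in> A then a x y else 0)"
  by (auto simp: pr_def dg_mult fun_eq_iff)

lemma state_pr_Un:
  assumes "is_state n \<phi>" "A \<inter> B = {}"
  shows "\<phi> (pr n (A \<union> B)) = \<phi> (pr n A) + \<phi> (pr n B)"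
proof -
  have "pr n (A \<union> B) = mat_add (pr n A) (pr n B)"
    using assms(2) by (auto simp: pr_def mat_add_def dg_def fun_eq_iff)
  then show ?thesis using state_add[OF assms(1)] by simp
qed

lemma state_pr_sum:
  assumes "is_state n \<phi>" "finite I" "disjoint_family_on A I"
  shows "\<phi> (pr n (\<Union>i\<in>I. A i)) = (\<Sum>i\<in>I. \<phi> (pr n (A i)))"
  using assms(2,3)
proof (induction I)
  case empty
  have "pr n {} = mat_scale 0 (pr n {})"
    by (auto simp: pr_def mat_scale_def dg_def)
  then show ?case
    using state_scale[OF assms(1) pr_Cu, of 0] by (metis UN_empty mult_zero_left sum.empty)
next
  case (insert i I)
  then have "A i \<inter> (\<Union>i\<in>I. A i) = {}" "disjoint_family_on A I"
    by (auto simp: disjoint_family_on_def)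
  then show ?case
    using insert state_pr_Un[OF assms(1)] by simp
qed

text \<open>Words outside the tree are invisible to \<open>pr\<close>, so \<open>UNIV\<close>,
  complements and images can be used as sets of words without intersecting them with
  \<open>Tn n\<close>.\<close>

lemma pr_cong: "A \<inter> Tn n = B \<inter> Tn n \<Longrightarrow> pr n A = pr n B"
  by (auto simp: pr_def dg_def fun_eq_iff)

lemma state_pr_UNIV: "is_state n \<phi> \<Longrightarrow> \<phi> (pr n UNIV) = 1"
  using state_id[of n \<phi>] by (simp add: pr_def mat_id_dg)

lemma state_pr_nonneg: "is_state n \<phi> \<Longrightarrow> 0 \<le> Re (\<phi> (pr n A))"
  using state_nonneg[of n \<phi> "pr n A"] by simp

section \<open>Consequences of the KMS condition\<close>

text \<open>A matrix that is homogeneous of degree \<open>m\<close> for the grading by \<open>h\<close> is an eigenvector of the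
  dynamics, with entire orbit \<open>z \<mapsto> exp (\<i> * z * m) \<cdot> b\<close>.\<close>
lemma homogeneous_entire_ext:
  assumes b: "b \<in> Cu n" and m: "\<And>x y. b x y \<noteq> 0 \<Longrightarrow> h x - h y = m"
  shows "entire_ext n h b (\<lambda>z. mat_scale (exp (\<i> * z * of_real m)) b)"
  unfolding entire_ext_def
proof (intro conjI allI)
  let ?e = "\<lambda>z. exp (\<i> * z * of_real m)"
  show "mat_scale (?e z) b \<in> Cu n" for z
    by (intro Cu_scale b)
  show "mat_scale (?e (of_real t)) b = sigma h t b" for t
    using m by (force simp: mat_scale_def sigma_def fun_eq_iff)
  fix z
  define D where "D = \<i> * of_real m * ?e z"
  show "\<exists>D\<in>Cu n. ((\<lambda>w. opnorm n (mat_diff (mat_diff (mat_scale (?e w) b) (mat_scale (?e z) b))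
      (mat_scale (w - z) D)) / cmod (w - z)) \<longlongrightarrow> 0) (at z)"
  proof (intro bexI[of _ "mat_scale D b"] Cu_scale b)
    \<comment> \<open>Every term is a scalar multiple of \<open>b\<close>, so differentiability in
      norm reduces to that of the scalar exponential.\<close>
    have eq: "mat_diff (mat_diff (mat_scale (?e w) b) (mat_scale (?e z) b)) (mat_scale (w - z) (mat_scale D b))
      = mat_scale (?e w - ?e z - (w - z) * D) b" for w
      by (simp add: mat_diff_def mat_scale_def fun_eq_iff algebra_simps)
    have up: "opnorm n (mat_scale c b) \<le> cmod c * opnorm n b" for c
      by (intro opnorm_le sbd_scale Cu_sbd b)
    have lo: "0 \<le> opnorm n (mat_scale c b)" for c
      using sbd_nonneg[OF Cu_sbd] Cu_scale[OF b] by blast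
    have "(?e has_field_derivative D) (at z)"
      unfolding D_def by (auto intro!: derivative_eq_intros)
    then have "((\<lambda>w. (?e w - ?e z) / (w - z) - D) \<longlongrightarrow> 0) (at z)"
      unfolding has_field_derivative_iff by (simp add: LIM_zero)
    then have A: "((\<lambda>w. cmod ((?e w - ?e z) / (w - z) - D) * opnorm n b) \<longlongrightarrow> 0) (at z)"
      by (intro tendsto_mult_left_zero tendsto_norm_zero)
    have B: "\<forall>\<^sub>F w in at z. opnorm n (mat_scale (?e w - ?e z - (w - z) * D) b) / cmod (w - z)
        \<le> cmod ((?e w - ?e z) / (w - z) - D) * opnorm n b"
      unfolding eventually_at_filter
    proof (intro always_eventually allI impI)
      fix w assume "w \<noteq> z"
      then have "(?e w - ?e z) / (w - z) - D = (?e w - ?e z - (w - z) * D) / (w - z)"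
        by (simp add: diff_divide_distrib)
      then show "opnorm n (mat_scale (?e w - ?e z - (w - z) * D) b) / cmod (w - z)
        \<le> cmod ((?e w - ?e z) / (w - z) - D) * opnorm n b"
        using divide_right_mono[OF up norm_ge_zero, of "?e w - ?e z - (w - z) * D" "w - z"]
        by (simp only: norm_divide times_divide_eq_left)
    qed
    have L: "\<forall>\<^sub>F w in at z. 0 \<le> opnorm n (mat_scale (?e w - ?e z - (w - z) * D) b) / cmod (w - z)"
      by (intro always_eventually allI divide_nonneg_nonneg lo norm_ge_zero)
    show "((\<lambda>w. opnorm n (mat_diff (mat_diff (mat_scale (?e w) b) (mat_scale (?e z) b))
      (mat_scale (w - z) (mat_scale D b))) / cmod (w - z)) \<longlongrightarrow> 0) (at z)"
      unfolding eq by (rule tendsto_sandwich[OF L B tendsto_const A])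
  qed
qed

abbreviation len :: "word \<Rightarrow> real" where
  "len \<equiv> \<lambda>x. real (length x)"

lemma KMS_state: "is_KMS n h \<beta> \<phi> \<Longrightarrow> is_state n \<phi>"
  by (simp add: is_KMS_def)

text \<open>At \<open>\<i> * \<beta>\<close> the phase of the orbit becomes the real factor
  \<open>exp (- \<beta> * m)\<close>. All consequences drawn for an arbitrary KMS state rest on this
  case.\<close>

lemma KMS_homogeneous:
  assumes "is_KMS n h \<beta> \<phi>" and a: "a \<in> Cu n" and b: "b \<in> Cu n"
    and "\<And>x y. b x y \<noteq> 0 \<Longrightarrow> h x - h y = m"
  shows "of_real (exp (- \<beta> * m)) * \<phi> (mat_mult a b) = \<phi> (mat_mult b a)"
proof -
  have "\<phi> (mat_mult a (mat_scale (exp (\<i> * (\<i> * of_real \<beta>) * of_real m)) b)) = \<phi> (mat_mult b a)"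
    using assms homogeneous_entire_ext[of b n h m, OF b assms(4)] unfolding is_KMS_def by blast
  moreover have "\<i> * (\<i> * of_real \<beta>) * of_real m = complex_of_real (- \<beta> * m)"
    by (simp flip: mult.assoc)
  ultimately show ?thesis
    using state_scale[OF KMS_state[OF assms(1)] Cu_mult[OF a b]]
    by (metis mat_mult_scale_right exp_of_real)
qed

text \<open>This is degree 0, where the factor is 1. It permits cutting a matrix by a diagonal on
  one side only and then moving the diagonal to the other side under \<phi>.\<close>

lemma KMS_dg:
  assumes "is_KMS n h \<beta> \<phi>" "a \<in> Cu n" "dg n g \<in> Cu n"
  shows "\<phi> (mat_mult a (dg n g)) = \<phi> (mat_mult (dg n g) a)"
  using KMS_homogeneous[OF assms, of 0] by (simp add: dg_def split: if_splits)

text \<open>Let \<open>v = crt n i\<close> and let \<open>a\<close> be \<open>pr n A\<close> times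
  the adjoint of \<open>v\<close>. Since \<open>v\<close> is an isometry, \<open>a v\<close> is
  \<open>pr n A\<close>, while \<open>v a\<close> is the projection onto the words of
  \<open>A\<close> prolonged by \<open>i\<close>; \<open>v\<close> has degree 1.\<close>

lemma KMS_pr_snoc:
  assumes K: "is_KMS n len \<beta> \<phi>" and i: "i \<in> {1..n}"
  shows "\<phi> (pr n ((\<lambda>x. x @ [i]) ` A)) = of_real (exp (- \<beta>)) * \<phi> (pr n A)"
proof -
  define a where "a = mat_mult (pr n A) (mat_adj (crt n i))"
  have a: "a \<in> Cu n"
    unfolding a_def by (intro Cu_mult pr_Cu Cu_adj crt_Cu i)
  have a_eq: "a x y = (if x \<in> A \<and> x \<in> Tn n \<and> y = x @ [i] then 1 else 0)" for x y
    unfolding a_def by (simp add: pr_mult supp_adj supp_crt[OF i]) (simp add: mat_adj_def crt_def)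
  have "of_real (exp (- \<beta> * 1)) * \<phi> (mat_mult a (crt n i)) = \<phi> (mat_mult (crt n i) a)"
    by (rule KMS_homogeneous[OF K a crt_Cu[OF i]]) (auto simp: crt_def split: if_splits)
  moreover have "mat_mult a (crt n i) = pr n A"
    by (auto simp: mult_crt a_eq pr_def dg_def fun_eq_iff)
  moreover have "mat_mult (crt n i) a = pr n ((\<lambda>x. x @ [i]) ` A)"
  proof (intro ext)
    fix x y
    have Tn: "w @ [i] \<in> Tn n \<longleftrightarrow> w \<in> Tn n" for w using i by (auto simp: Tn_def)
    show "mat_mult (crt n i) a x y = pr n ((\<lambda>x. x @ [i]) ` A) x y"
      by (cases x rule: rev_cases) (auto simp: crt_mult[OF Cu_supp[OF a]] a_eq pr_def dg_def Tn)
  qed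
  ultimately show ?thesis by simp
qed

lemma KMS_pr_word:
  assumes "is_KMS n len \<beta> \<phi>" "x \<in> Tn n"
  shows "\<phi> (pr n {x}) = of_real (exp (- \<beta> * len x)) * \<phi> (pr n {[]})"
  using assms(2)
proof (induction x rule: rev_induct)
  case (snoc i x)
  then have "i \<in> {1..n}" "x \<in> Tn n" by (auto simp: Tn_def)
  then have "\<phi> (pr n {x @ [i]}) = of_real (exp (- \<beta>)) * (of_real (exp (- \<beta> * len x)) * \<phi> (pr n {[]}))"
    using KMS_pr_snoc[OF assms(1), of i "{x}"] snoc by simp
  also have "\<dots> = of_real (exp (- \<beta> * len (x @ [i]))) * \<phi> (pr n {[]})"
    by (simp add: algebra_simps flip: exp_add of_real_mult)
  finally show ?case .
qed simp

lemma KMS_pr_root: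
  assumes K: "is_KMS n len \<beta> \<phi>"
  shows "\<phi> (pr n {[]}) = of_real (1 - real n * exp (- \<beta>))"
proof -
  note st = KMS_state[OF K]
  \<comment> \<open>Nonempty words of the tree are sorted by their last letter, because
    \<open>crt\<close> appends on the right.\<close>
  let ?A = "\<lambda>i. (\<lambda>x. x @ [i]) ` (UNIV :: word set)"
  have eq: "UNIV \<inter> Tn n = ({[]} \<union> (\<Union>i\<in>{1..n}. ?A i)) \<inter> Tn n"
  proof -
    have "x = [] \<or> (\<exists>i\<in>{1..n}. x \<in> ?A i)" if "x \<in> Tn n" for x
      using that by (cases x rule: rev_cases) (auto simp: Tn_def image_iff)
    then show ?thesis by blast
  qed
  have "1 = \<phi> (pr n ({[]} \<union> (\<Union>i\<in>{1..n}. ?A i)))"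
    using state_pr_UNIV[OF st] pr_cong[OF eq] by simp
  also have "\<dots> = \<phi> (pr n {[]}) + \<phi> (pr n (\<Union>i\<in>{1..n}. ?A i))"
    by (rule state_pr_Un[OF st]) auto
  also have "\<phi> (pr n (\<Union>i\<in>{1..n}. ?A i)) = (\<Sum>i\<in>{1..n}. \<phi> (pr n (?A i)))"
    by (rule state_pr_sum[OF st]) (auto simp: disjoint_family_on_def)
  also have "\<dots> = (\<Sum>i\<in>{1..n}. of_real (exp (- \<beta>)))"
    by (intro sum.cong refl) (simp add: KMS_pr_snoc[OF K] state_pr_UNIV[OF st])
  finally show ?thesis by (simp add: algebra_simps)
qed

lemma KMS_ge_ln:
  assumes K: "is_KMS n len \<beta> \<phi>" and "n \<ge> 1"
  shows "\<beta> \<ge> ln (real n)"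
proof -
  have "0 \<le> 1 - real n * exp (- \<beta>)"
    using state_pr_nonneg[OF KMS_state[OF K], of "{[]}"] by (simp add: KMS_pr_root[OF K] del: of_real_diff)
  then have "real n \<le> exp \<beta>"
    by (simp add: exp_minus field_simps)
  then have "ln (real n) \<le> ln (exp \<beta>)"
    using \<open>n \<ge> 1\<close> by (subst ln_le_cancel_iff) auto
  then show ?thesis by simp
qed

text \<open>Moving the projection through \<phi> turns the one-sided cut into the compression of
  \<open>a\<close> to the line spanned by the basis vector at \<open>x\<close>, and this is a scalar
  multiple of the projection.\<close>

lemma KMS_pr_mult:
  assumes K: "is_KMS n h \<beta> \<phi>" and a: "a \<in> Cu n" and x: "x \<in> Tn n"
  shows "\<phi> (mat_mult (pr n {x}) a) = a x x * \<phi> (pr n {x})"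
proof -
  define b where "b = mat_mult (pr n {x}) a"
  have b: "b \<in> Cu n" unfolding b_def using a by (simp add: Cu_mult)
  have b_eq: "b u v = (if u = x then a u v else 0)" for u v
    by (simp add: b_def pr_mult Cu_supp[OF a])
  have "\<phi> (mat_mult b (pr n {x})) = \<phi> (mat_mult (pr n {x}) b)"
    using KMS_dg[OF K b] pr_Cu[of n "{x}"] by (simp add: pr_def)
  moreover have "mat_mult (pr n {x}) b = b"
    by (auto simp: pr_mult Cu_supp[OF b] b_eq fun_eq_iff)
  moreover have "mat_mult b (pr n {x}) = mat_scale (a x x) (pr n {x})"
    unfolding pr_def mult_dg[OF Cu_supp[OF b]]
    using x by (auto simp: b_eq mat_scale_def dg_def fun_eq_iff)
  ultimately show ?thesis
    using state_scale[OF KMS_state[OF K]] b_def by simp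
qed

lemma KMS_pr_finite_mult:
  assumes K: "is_KMS n h \<beta> \<phi>" and a: "a \<in> Cu n" and F: "finite F" "F \<subseteq> Tn n"
  shows "\<phi> (mat_mult (pr n F) a) = (\<Sum>x\<in>F. a x x * \<phi> (pr n {x}))"
  using F
proof (induction F)
  case empty
  have "mat_mult (pr n {}) a = mat_scale 0 a"
    by (simp add: pr_mult Cu_supp[OF a] mat_scale_def)
  then show ?case using state_scale[OF KMS_state[OF K] a, of 0] by simp
next
  case (insert x F)
  have "mat_mult (pr n (insert x F)) a = mat_add (mat_mult (pr n {x}) a) (mat_mult (pr n F) a)"
    using insert by (auto simp: pr_mult Cu_supp[OF a] mat_add_def fun_eq_iff)
  then show ?case
    using insert KMS_pr_mult[OF K a] a by (simp add: state_add[OF KMS_state[OF K]] Cu_mult)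
qed

section \<open>Levels of the tree\<close>

text \<open>With the strict inequality \<open>lev n 0\<close> is empty, so the partial sums of the
  weights start at 0.\<close>

definition lev :: "nat \<Rightarrow> nat \<Rightarrow> word set" where
  "lev n N = {x \<in> Tn n. length x < N}"

text \<open>Written as in the claimed formula; factored in \<open>wt_eq\<close>, it is a Boltzmann
  weight times, above the threshold, the reciprocal of the partition function.\<close>

definition wt :: "nat \<Rightarrow> real \<Rightarrow> word \<Rightarrow> real" where
  "wt n \<beta> x = exp (- \<beta> * len x) - real n * exp (- \<beta> * (len x + 1))"

lemma wt_eq: "wt n \<beta> x = exp (- \<beta> * len x) * (1 - real n * exp (- \<beta>))"
proof -
  have "exp (- \<beta> * (len x + 1)) = exp (- \<beta> * len x) * exp (- \<beta>)"
    by (simp add: algebra_simps flip: exp_add)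
  then show ?thesis by (simp add: wt_def algebra_simps)
qed

lemma lev_Suc: "lev n (Suc N) = lev n N \<union> {x. set x \<subseteq> {1..n} \<and> length x = N}"
  by (auto simp: lev_def Tn_def)

lemma finite_lev: "finite (lev n N)"
proof (induction N)
  case (Suc N)
  then show ?case unfolding lev_Suc using finite_lists_length_eq[of "{1..n}" N] by simp
qed (simp add: lev_def)

text \<open>With \<open>r = n exp (- \<beta>)\<close>, the \<open>n ^ N\<close> words of length
  \<open>N\<close> contribute \<open>r ^ N * (1 - r)\<close> in total, so the sum telescopes. Its
  defect from 1 is the value of a KMS state on the words of length at least
  \<open>N\<close>.\<close>

lemma sum_wt_lev: "(\<Sum>x\<in>lev n N. wt n \<beta> x) = 1 - (real n * exp (- \<beta>)) ^ N"
proof (induction N)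
  case (Suc N)
  let ?L = "{x. set x \<subseteq> {1..n} \<and> length x = N}"
  have "(\<Sum>x\<in>lev n (Suc N). wt n \<beta> x) = (\<Sum>x\<in>lev n N. wt n \<beta> x) + (\<Sum>x\<in>?L. wt n \<beta> x)"
    unfolding lev_Suc
    using finite_lists_length_eq[of "{1..n}" N] finite_lev[of n N]
    by (intro sum.union_disjoint) (auto simp: lev_def)
  also have "(\<Sum>x\<in>?L. wt n \<beta> x) = (\<Sum>x\<in>?L. exp (- \<beta> * real N) * (1 - real n * exp (- \<beta>)))"
    by (intro sum.cong) (auto simp: wt_eq)
  also have "\<dots> = (real n * exp (- \<beta>)) ^ N * (1 - real n * exp (- \<beta>))"
    using card_lists_length_eq[of "{1..n}" N]
    by (simp add: power_mult_distrib exp_of_nat_mult[symmetric] mult_ac)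
  finally show ?case using Suc by (simp add: algebra_simps)
qed (simp add: lev_def)

lemma lev_exhausts: "finite F \<Longrightarrow> F \<subseteq> Tn n \<Longrightarrow> \<exists>N. F \<subseteq> lev n N"
proof -
  assume F: "finite F" "F \<subseteq> Tn n"
  then have "x \<in> F \<Longrightarrow> length x < Suc (Max (length ` F))" for x
    by (simp add: le_imp_less_Suc)
  then show ?thesis using F by (intro exI[of _ "Suc (Max (length ` F))"]) (auto simp: lev_def)
qed

lemma lev_mono: "M \<le> N \<Longrightarrow> lev n M \<subseteq> lev n N"
  by (auto simp: lev_def)

text \<open>The levels are cofinal among finite sets of words of the tree, so a convergent unordered
  sum is the limit of a sequence of partial sums.\<close>

lemma lev_tendsto: "filterlim (lev n) (finite_subsets_at_top (Tn n)) sequentially"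
  unfolding filterlim_finite_subsets_at_top
proof (intro allI impI)
  fix X :: "word set" assume "finite X \<and> X \<subseteq> Tn n"
  then obtain N where "X \<subseteq> lev n N" using lev_exhausts by blast
  then have "X \<subseteq> lev n M" if "N \<le> M" for M using lev_mono[OF that] by blast
  then show "\<forall>\<^sub>F y in sequentially. finite (lev n y) \<and> X \<subseteq> lev n y \<and> lev n y \<subseteq> Tn n"
    using finite_lev by (auto simp: eventually_sequentially lev_def)
qed

lemma wt_nonneg:
  assumes "\<beta> \<ge> ln (real n)" "n \<ge> 1"
  shows "0 \<le> wt n \<beta> x"
proof -
  have "exp (ln (real n)) \<le> exp \<beta>" using assms(1) by (simp only: exp_le_cancel_iff)
  then have "real n \<le> exp \<beta>" using assms(2) by (subst (asm) exp_ln) auto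
  then show ?thesis by (simp add: wt_eq exp_minus field_simps)
qed

lemma wt_summable:
  assumes "\<beta> \<ge> ln (real n)" "n \<ge> 1"
  shows "wt n \<beta> summable_on Tn n"
proof (rule nonneg_bdd_above_summable_on)
  show "bdd_above (sum (wt n \<beta>) ` {F. F \<subseteq> Tn n \<and> finite F})"
  proof (rule bdd_aboveI2[where M=1])
    fix F assume F: "F \<in> {F. F \<subseteq> Tn n \<and> finite F}"
    then obtain N where "F \<subseteq> lev n N" using lev_exhausts by blast
    then have "sum (wt n \<beta>) F \<le> sum (wt n \<beta>) (lev n N)"
      using wt_nonneg[OF assms] finite_lev by (intro sum_mono2) auto
    then show "sum (wt n \<beta>) F \<le> 1" by (simp add: sum_wt_lev) (smt (verit) exp_ge_zero of_nat_0_le_iff zero_le_mult_iff zero_le_power)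
  qed
qed (use wt_nonneg[OF assms] in auto)

lemma ratio_tendsto:
  assumes "\<beta> > ln (real n)" "n \<ge> 1"
  shows "(\<lambda>N. (real n * exp (- \<beta>)) ^ N) \<longlonglongrightarrow> 0"
proof (rule LIMSEQ_realpow_zero)
  have "ln (real n) < ln (exp \<beta>)" using assms by simp
  then have "real n < exp \<beta>" using assms(2) by (subst (asm) ln_less_cancel_iff) auto
  then show "real n * exp (- \<beta>) < 1" by (simp add: exp_minus field_simps)
qed simp

lemma KMS_formula:
  assumes K: "is_KMS n len \<beta> \<phi>" and n: "n \<ge> 1" and \<beta>: "\<beta> > ln (real n)" and a: "a \<in> Cu n"
  shows "\<phi> a = (\<Sum>\<^sub>\<infinity>y\<in>Tn n. a y y * of_real (wt n \<beta> y))"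
proof -
  note st = KMS_state[OF K]
  have w: "\<phi> (pr n {x}) = of_real (wt n \<beta> x)" if "x \<in> Tn n" for x
    using KMS_pr_word[OF K that] by (simp add: KMS_pr_root[OF K] wt_eq)
  define P where "P N = mat_mult (pr n (lev n N)) a" for N
  have P: "\<phi> (P N) = (\<Sum>x\<in>lev n N. a x x * of_real (wt n \<beta> x))" for N
    unfolding P_def using KMS_pr_finite_mult[OF K a finite_lev, of n N] w by (auto simp: lev_def)
  define C where "C = Re (\<phi> (mat_mult (mat_adj a) a))"
  \<comment> \<open>Since \<open>q\<close> is a self-adjoint idempotent, Cauchy-Schwarz leaves
    \<open>C\<close> times the value of \<phi> on \<open>q\<close>, and that value is the geometric
    defect of \<open>sum_wt_lev\<close>.\<close>
  have bound: "cmod (\<phi> a - \<phi> (P N)) \<le> sqrt (C * (real n * exp (- \<beta>)) ^ N)" for N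
  proof -
    define q where "q = pr n (- lev n N)"
    have "a = mat_add (P N) (mat_mult q a)"
      by (auto simp: P_def q_def pr_mult Cu_supp[OF a] mat_add_def fun_eq_iff)
    then have "\<phi> a = \<phi> (P N) + \<phi> (mat_mult q a)"
      using state_add[OF st, of "P N" "mat_mult q a"] a by (simp add: P_def q_def Cu_mult)
    moreover have "(cmod (\<phi> (mat_mult q a)))\<^sup>2 \<le> C * Re (\<phi> q)"
      using state_cauchy_schwarz[OF st a, of q] by (simp add: q_def C_def)
    moreover have "Re (\<phi> q) = (real n * exp (- \<beta>)) ^ N"
    proof -
      have "\<phi> (pr n (lev n N \<union> - lev n N)) = \<phi> (pr n (lev n N)) + \<phi> q"
        unfolding q_def by (rule state_pr_Un[OF st]) auto
      moreover have "lev n N \<union> - lev n N = UNIV" by auto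
      moreover have "\<phi> (pr n (lev n N)) = (\<Sum>x\<in>lev n N. \<phi> (pr n {x}))"
        using state_pr_sum[OF st finite_lev[of n N], of "\<lambda>x. {x}"] by (simp add: disjoint_family_on_def)
      moreover have "(\<Sum>x\<in>lev n N. \<phi> (pr n {x})) = of_real (\<Sum>x\<in>lev n N. wt n \<beta> x)"
        unfolding of_real_sum by (intro sum.cong w) (auto simp: lev_def)
      ultimately show ?thesis
        using state_pr_UNIV[OF st] by (simp add: sum_wt_lev complex_eq_iff del: of_real_diff of_real_power of_real_mult)
    qed
    ultimately show ?thesis by (simp add: real_le_rsqrt)
  qed
  have "(\<lambda>N. \<phi> a - \<phi> (P N)) \<longlonglongrightarrow> 0"
  proof (rule Lim_null_comparison[OF always_eventually])
    show "\<forall>N. cmod (\<phi> a - \<phi> (P N)) \<le> sqrt (C * (real n * exp (- \<beta>)) ^ N)" using bound by blast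
    have "(\<lambda>N. sqrt (C * (real n * exp (- \<beta>)) ^ N)) \<longlonglongrightarrow> sqrt (C * 0)"
      by (intro tendsto_intros ratio_tendsto n \<beta>)
    then show "(\<lambda>N. sqrt (C * (real n * exp (- \<beta>)) ^ N)) \<longlonglongrightarrow> 0" by simp
  qed
  then have lim: "(\<lambda>N. \<phi> (P N)) \<longlonglongrightarrow> \<phi> a"
    using tendsto_diff[OF tendsto_const[of "\<phi> a"]] by fastforce
  \<comment> \<open>Summability is secured first, for otherwise \<open>infsum\<close> could be a
    default value unrelated to the partial sums.\<close>
  have "(\<lambda>y. a y y * of_real (wt n \<beta> y)) summable_on Tn n"
  proof (rule abs_summable_summable[OF Infinite_Sum.abs_summable_on_comparison_test'])
    show "(\<lambda>y. opnorm n a * wt n \<beta> y) summable_on Tn n"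
      using \<beta> n by (intro summable_on_cmult_right wt_summable) auto
    show "norm (a y y * of_real (wt n \<beta> y)) \<le> opnorm n a * wt n \<beta> y" for y
      using sbd_entry[OF Cu_sbd[OF a]] wt_nonneg[of n \<beta> y] \<beta> n by (simp add: norm_mult mult_right_mono)
  qed
  then have "(\<lambda>N. \<Sum>x\<in>lev n N. a x x * of_real (wt n \<beta> x)) \<longlonglongrightarrow> (\<Sum>\<^sub>\<infinity>y\<in>Tn n. a y y * of_real (wt n \<beta> y))"
    using filterlim_compose[OF infsum_tendsto lev_tendsto] by blast
  with lim show ?thesis unfolding P by (rule LIMSEQ_unique)
qed

section \<open>Compact matrices\<close>

definition tail :: "nat \<Rightarrow> nat \<Rightarrow> (word \<Rightarrow> complex) \<Rightarrow> word \<Rightarrow> complex" where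
  "tail n N f = (\<lambda>x. if x \<in> lev n N then 0 else f x)"

lemma tail_l2:
  assumes "l2 f"
  shows "l2 (tail n N f)" "M \<le> N \<Longrightarrow> ell2norm (tail n N f) \<le> ell2norm (tail n M f)"
proof -
  show *: "l2 (tail n N f)" for N
    by (rule l2_mono[OF assms]) (auto simp: tail_def)
  show "M \<le> N \<Longrightarrow> ell2norm (tail n N f) \<le> ell2norm (tail n M f)"
    by (rule l2_mono[OF *]) (use lev_mono[of M N n] in \<open>auto simp: tail_def\<close>)
qed

lemma tail_small:
  assumes "v \<in> ell2 n" "e > 0"
  shows "\<exists>N. ell2norm (tail n N v) \<le> e"
proof -
  let ?g = "\<lambda>x. (cmod (v x))\<^sup>2"
  have v: "l2 v" "\<And>x. x \<notin> Tn n \<Longrightarrow> v x = 0" using assms by (auto simp: ell2_iff)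
  have sm: "?g summable_on UNIV" using v by (simp add: l2_def)
  obtain F where F: "finite F" "dist (sum ?g F) (infsum ?g UNIV) \<le> e\<^sup>2"
    using infsum_finite_approximation[OF sm, of "e\<^sup>2"] \<open>e > 0\<close> by auto
  obtain N where N: "F \<inter> Tn n \<subseteq> lev n N"
    using lev_exhausts[of "F \<inter> Tn n" n] F by auto
  have "fnorm S (tail n N v) \<le> e" if S: "finite S" for S
  proof -
    have "(\<Sum>x\<in>S. (cmod (tail n N v x))\<^sup>2) = (\<Sum>x\<in>S - lev n N - F. ?g x)"
      using S N v(2) by (intro sum.mono_neutral_cong_right) (auto simp: tail_def)
    also have "\<dots> = (\<Sum>x\<in>(S - lev n N - F) \<union> F. ?g x) - sum ?g F"
      using S F by (subst sum.union_disjoint) auto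
    also have "(\<Sum>x\<in>(S - lev n N - F) \<union> F. ?g x) \<le> infsum ?g UNIV"
      using S F sm by (intro finite_sum_le_infsum) auto
    finally have "(\<Sum>x\<in>S. (cmod (tail n N v x))\<^sup>2) \<le> e\<^sup>2"
      using F(2) by (simp add: dist_real_def)
    then show ?thesis
      using \<open>e > 0\<close> by (simp add: L2_set_def real_le_lsqrt)
  qed
  then show ?thesis using l2_bound(2) by blast
qed

text \<open>Bounded subsets of a finite-dimensional space have uniformly small tails. The spanning
  functions \<open>u i\<close> need not be square-summable, so one eliminates a member \<open>v\<close> of the set itself,
  using evaluation at a point where \<open>v\<close> does not vanish as the coordinate.\<close>
lemma tail_uniformly_small:
  fixes k :: nat
  assumes "\<And>w. w \<in> B \<Longrightarrow> w \<in> ell2 n" "\<And>w. w \<in> B \<Longrightarrow> ell2norm w \<le> C"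
    and "\<And>w. w \<in> B \<Longrightarrow> \<exists>c. w = (\<lambda>x. \<Sum>i<k. c i * u i x)"
    and "e > 0"
  shows "\<exists>N. \<forall>w\<in>B. ell2norm (tail n N w) \<le> e"
  using assms
proof (induction k arbitrary: B C u e)
  case 0
  then have *: "w = (\<lambda>x. 0)" if "w \<in> B" for w using that by force
  have "ell2norm (tail n 0 w) \<le> e" if "w \<in> B" for w
  proof -
    have "tail n 0 w = (\<lambda>x. 0)" using *[OF that] by (auto simp: tail_def)
    then show ?thesis using \<open>e > 0\<close> by (simp add: ell2norm_def)
  qed
  then show ?case by blast
next
  case (Suc k)
  show ?case
  proof (cases "\<forall>w\<in>B. \<exists>c. w = (\<lambda>x. \<Sum>i<k. c i * u i x)")
    case True
    then show ?thesis using Suc.IH[of B C u e] Suc.prems by blast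
  next
    case False
    then obtain v where vB: "v \<in> B" and nv: "\<And>c. v \<noteq> (\<lambda>x. \<Sum>i<k. c i * u i x)" by blast
    obtain d where d: "v = (\<lambda>x. \<Sum>i<Suc k. d i * u i x)" using Suc.prems(3)[OF vB] by blast
    have dk: "d k \<noteq> 0" using d nv[of d] by auto
    obtain x0 where x0: "v x0 \<noteq> 0" using nv[of "\<lambda>_. 0"] by force
    have v: "v \<in> ell2 n" "l2 v" using Suc.prems(1)[OF vB] by (auto simp: ell2_iff)
    \<comment> \<open>\<open>p\<close> is linear, kills \<open>v\<close> and makes every function
      vanish at \<open>x0\<close>; it plays the role of the quotient by \<open>v\<close>.\<close>
    define p where "p = (\<lambda>w x. w x + (- (w x0 / v x0)) * v x)"
    have C: "C \<ge> 0" using Suc.prems(2)[OF vB] ell2norm_nonneg[of v] by linarith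
    have coef: "cmod (w x0 / v x0) \<le> C / cmod (v x0)" if "w \<in> B" for w
    proof -
      have "cmod (w x0) \<le> C"
        using cmod_le_ell2norm[of w x0] Suc.prems(1,2)[OF that] by (auto simp: ell2_iff)
      then show ?thesis by (simp add: norm_divide divide_right_mono)
    qed
    have l2p: "l2 (p w)" "ell2norm (p w) \<le> ell2norm w + cmod (w x0 / v x0) * ell2norm v" if "w \<in> B" for w
    proof -
      have w: "l2 w" using Suc.prems(1)[OF that] by (auto simp: ell2_iff)
      show "l2 (p w)" "ell2norm (p w) \<le> ell2norm w + cmod (w x0 / v x0) * ell2norm v"
        using l2_add[OF w l2_scale(1)[OF v(2), of "- (w x0 / v x0)"]] l2_scale(2)[OF v(2), of "- (w x0 / v x0)"]
        by (simp_all only: p_def norm_minus_cancel)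
    qed
    have "\<exists>N. \<forall>w\<in>p ` B. ell2norm (tail n N w) \<le> e / 2"
    proof (rule Suc.IH[of "p ` B" "C + C / cmod (v x0) * C" "\<lambda>i. p (u i)"])
      fix w' assume "w' \<in> p ` B"
      then obtain w where w: "w \<in> B" "w' = p w" by auto
      show "w' \<in> ell2 n"
        using Suc.prems(1)[OF w(1)] l2p(1)[OF w(1)] v(1) by (auto simp: w(2) ell2_iff p_def)
      have "cmod (w x0 / v x0) * ell2norm v \<le> C / cmod (v x0) * C"
        using Suc.prems(2)[OF vB] coef[OF w(1)] C by (intro mult_mono ell2norm_nonneg) auto
      then show "ell2norm w' \<le> C + C / cmod (v x0) * C"
        using l2p(2)[OF w(1)] Suc.prems(2)[OF w(1)] unfolding w(2) by linarith
      obtain c where c: "w = (\<lambda>x. \<Sum>i<Suc k. c i * u i x)" using Suc.prems(3)[OF w(1)] by blast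
      \<comment> \<open>Subtracting \<open>c k / d k\<close> times \<open>v\<close> from
        \<open>w\<close> cancels the coefficient of \<open>u k\<close>; as \<open>p\<close> kills
        \<open>v\<close>, this does not change \<open>p w\<close>.\<close>
      define c' where "c' i = c i - c k * d i / d k" for i
      have wx: "w x = (\<Sum>i<k. c' i * u i x) + c k / d k * v x" for x
      proof -
        have "(\<Sum>i<k. c' i * u i x) = (\<Sum>i<k. c i * u i x) - c k / d k * (\<Sum>i<k. d i * u i x)"
          by (simp add: c'_def left_diff_distrib sum_subtractf sum_distrib_left mult.assoc)
        then show ?thesis using dk by (simp add: c d field_simps)
      qed
      have "w' = (\<lambda>x. \<Sum>i<k. c' i * p (u i) x)"
      proof
        fix x
        have "(\<Sum>i<k. c' i * p (u i) x) = (\<Sum>i<k. c' i * u i x) - (\<Sum>i<k. c' i * u i x0) / v x0 * v x"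
          by (simp add: p_def right_diff_distrib sum_subtractf sum_distrib_right sum_divide_distrib mult.assoc)
        also have "\<dots> = w x - w x0 / v x0 * v x"
          unfolding wx using x0 by (simp add: field_simps)
        finally show "w' x = (\<Sum>i<k. c' i * p (u i) x)" by (simp add: w(2) p_def)
      qed
      then show "\<exists>c. w' = (\<lambda>x. \<Sum>i<k. c i * p (u i) x)" by blast
    qed (use \<open>e > 0\<close> in auto)
    then obtain N1 where N1: "\<And>w. w \<in> B \<Longrightarrow> ell2norm (tail n N1 (p w)) \<le> e / 2" by blast
    \<comment> \<open>Chosen so that the tail of \<open>v\<close>, multiplied by the largest
      coefficient \<open>C / cmod (v x0)\<close>, stays below \<open>e / 2\<close>.\<close>
    define e' where "e' = e / 2 * cmod (v x0) / (C + 1)"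
    have "e' > 0" using \<open>e > 0\<close> x0 C by (simp add: e'_def)
    then obtain N2 where N2: "ell2norm (tail n N2 v) \<le> e'" using tail_small[OF v(1)] by blast
    show ?thesis
    proof (intro exI[of _ "max N1 N2"] ballI)
      fix w assume w: "w \<in> B"
      let ?N = "max N1 N2"
      have "tail n ?N w = (\<lambda>x. tail n ?N (p w) x + (w x0 / v x0) * tail n ?N v x)"
        by (auto simp: tail_def p_def)
      then have "ell2norm (tail n ?N w) \<le> ell2norm (tail n ?N (p w)) + cmod (w x0 / v x0) * ell2norm (tail n ?N v)"
        using l2_add(2)[OF tail_l2(1)[OF l2p(1)[OF w], of n ?N] l2_scale(1)[OF tail_l2(1)[OF v(2), of n ?N]]]
        by (simp only: l2_scale(2)[OF tail_l2(1)[OF v(2)]])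
      also have "ell2norm (tail n ?N (p w)) \<le> e / 2"
        using N1[OF w] tail_l2(2)[OF l2p(1)[OF w], of N1 ?N n] by simp
      also have "cmod (w x0 / v x0) * ell2norm (tail n ?N v) \<le> C / cmod (v x0) * e'"
        using N2 tail_l2(2)[OF v(2), of N2 ?N n] coef[OF w] C
        by (intro mult_mono ell2norm_nonneg) auto
      also have "C / cmod (v x0) * e' = C * (e / 2 / (C + 1))"
        using x0 by (simp add: e'_def)
      also have "\<dots> \<le> e / 2"
        using mult_div_add_one_le(1)[OF C, of "e / 2"] \<open>e > 0\<close> by simp
      finally show "ell2norm (tail n ?N w) \<le> e" by simp
    qed
  qed
qed

lemma sbd_pr: "sbd (pr n A) 1"
  unfolding pr_def by (rule sbd_dg) auto

lemma pr_subset_mult: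
  assumes "supp n a" "A \<subseteq> B" "sbd (mat_mult (pr n B) a) C"
  shows "sbd (mat_mult (pr n A) a) C"
proof -
  have "mat_mult (pr n A) a = mat_mult (pr n A) (mat_mult (pr n B) a)"
    using assms(2) unfolding pr_mult[OF supp_mult[OF Cu_supp[OF pr_Cu] assms(1)]]
    by (auto simp: pr_mult assms(1) fun_eq_iff)
  then show ?thesis using sbd_mult[OF sbd_pr assms(3), of n A] by simp
qed

text \<open>A finite-rank \<open>b\<close> maps the unit ball to a bounded subset of a
  finite-dimensional space, so its tails are uniformly small, which is a norm bound for the cut
  matrix. Enlarging \<open>N\<close> only shrinks the projection; the freedom
  \<open>N \<ge> M\<close> is later used to force \<open>N k \<ge> k\<close>.\<close>

lemma compact_mat_tail:
  assumes "compact_mat n a" "e > 0"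
  shows "\<exists>N\<ge>M. sbd (mat_mult (pr n (- lev n N)) a) e"
proof -
  have a: "bounded_mat n a" using assms by (simp add: compact_mat_def)
  have "e / 2 > 0" using assms by simp
  then obtain b where b: "finite_rank n b" "opnorm n (mat_diff a b) < e / 2"
    using assms unfolding compact_mat_def by blast
  have bb: "bounded_mat n b" using b by (simp add: finite_rank_def)
  have ab: "supp n a" "supp n b" "supp n (mat_diff a b)"
    using a bb by (auto simp: bounded_mat_supp supp_diff)
  have "bounded_mat n (mat_diff a b)"
    using ab sbd_diff[OF bounded_mat_sbd[OF a] bounded_mat_sbd[OF bb]] by (rule_tac bounded_matI)
  then have sab: "sbd (mat_diff a b) (e / 2)"
    using bounded_mat_sbd sbd_mono b(2) by (meson less_imp_le)
  obtain k u where u: "\<And>f. f \<in> ell2 n \<Longrightarrow> \<exists>c. mat_apply b f = (\<lambda>x. \<Sum>i<(k::nat). c i * u i x)"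
    using b(1) unfolding finite_rank_def by blast
  have bf: "mat_apply b f \<in> ell2 n \<and> ell2norm (mat_apply b f) \<le> opnorm n b" if f: "f \<in> ell2 n" "ell2norm f \<le> 1" for f
  proof -
    have "ell2norm (mat_apply b f) \<le> opnorm n b * ell2norm f"
      by (rule bounded_mat_opnorm_apply[OF bb f(1)])
    also have "\<dots> \<le> opnorm n b"
      using f(2) sbd_nonneg[OF bounded_mat_sbd[OF bb]] mult_left_le by blast
    finally show ?thesis
      using f bb by (simp add: bounded_mat_def) blast
  qed
  have "\<exists>N. \<forall>w\<in>{mat_apply b f |f. f \<in> ell2 n \<and> ell2norm f \<le> 1}. ell2norm (tail n N w) \<le> e / 2"
    by (rule tail_uniformly_small[where C="opnorm n b" and k=k and u=u]) (use bf u \<open>e > 0\<close> in auto)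
  then obtain N where N: "\<And>f. f \<in> ell2 n \<Longrightarrow> ell2norm f \<le> 1 \<Longrightarrow> ell2norm (tail n N (mat_apply b f)) \<le> e / 2"
    by blast
  let ?q = "pr n (- lev n N)"
  have qb: "mat_apply (mat_mult ?q b) f = tail n N (mat_apply b f)" for f
    by (auto simp: pr_mult[OF ab(2)] mat_apply_def tail_def fun_eq_iff)
  have "sbd (mat_mult ?q b) (opnorm n (mat_mult ?q b))"
    by (rule bounded_mat_sbd[OF bounded_matI[OF supp_mult[OF Cu_supp[OF pr_Cu] ab(2)]
          sbd_mult[OF sbd_pr bounded_mat_sbd[OF bb]]]])
  moreover have "opnorm n (mat_mult ?q b) \<le> e / 2"
    by (rule opnorm_leI) (simp only: qb N)
  ultimately have sqb: "sbd (mat_mult ?q b) (e / 2)"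
    by (rule sbd_mono)
  have "mat_mult ?q a = mat_add (mat_mult ?q (mat_diff a b)) (mat_mult ?q b)"
    unfolding ab[THEN pr_mult] by (auto simp: mat_add_def mat_diff_def fun_eq_iff)
  then have "sbd (mat_mult ?q a) e"
    using sbd_add[OF sbd_mult[OF sbd_pr sab] sqb, of n "- lev n N"] by simp
  moreover have "- lev n (max M N) \<subseteq> - lev n N"
    using lev_mono[of N "max M N" n] by auto
  ultimately have "sbd (mat_mult (pr n (- lev n (max M N))) a) e"
    using pr_subset_mult[OF ab(1)] by blast
  then show ?thesis by (intro exI[of _ "max M N"]) auto
qed

section \<open>Diagonal weights and vanishing on compact matrices\<close>

lemma sbd_sum:
  assumes "finite I" "\<And>k. k \<in> I \<Longrightarrow> sbd (m k) (C k)"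
  shows "sbd (\<lambda>x y. \<Sum>k\<in>I. m k x y) (\<Sum>k\<in>I. C k)"
  using assms
proof (induction I)
  case (insert k I)
  then have "sbd (mat_add (m k) (\<lambda>x y. \<Sum>k\<in>I. m k x y)) (C k + (\<Sum>k\<in>I. C k))"
    by (intro sbd_add) auto
  then show ?case using insert by (simp add: mat_add_def)
qed (simp add: sbd_zero)

lemma dg_mult_dg:
  assumes "supp n a"
  shows "mat_mult (mat_mult (dg n f) a) (dg n g) = (\<lambda>x y. f x * a x y * g y)"
  using mult_dg[OF supp_mult[OF supp_dg assms]] by (simp add: dg_mult[OF assms])

lemma dg_dg_mult:
  assumes "supp n a"
  shows "mat_mult (dg n f) (mat_mult (dg n g) a) = (\<lambda>x y. f x * g x * a x y)"
  using dg_mult[OF supp_mult[OF supp_dg assms]] by (simp add: dg_mult[OF assms] mult.assoc)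

text \<open>With \<open>G\<close> the diagonal of square roots and \<open>c\<close> the adjoint of
  \<open>b\<close> times \<open>G\<close>, the positive matrix formed from \<open>c\<close> has
  \<open>G\<close> on both sides of \<open>b\<close> times its adjoint; \<open>KMS_dg\<close> brings
  both factors together on the left. This gives monotonicity of \<phi> in the diagonal
  factor.\<close>

lemma KMS_dg_nonneg:
  assumes K: "is_KMS n h \<beta> \<phi>" and b: "b \<in> Cu n" and g: "\<And>x. 0 \<le> g x" "\<And>x. g x \<le> C"
  shows "0 \<le> Re (\<phi> (mat_mult (dg n (\<lambda>x. of_real (g x))) (mat_mult b (mat_adj b))))"
proof -
  define G where "G = dg n (\<lambda>x. of_real (sqrt (g x)))"
  define A where "A = mat_mult b (mat_adj b)"
  define c where "c = mat_mult (mat_adj b) G"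
  have G: "G \<in> Cu n" unfolding G_def by (rule dg_Cu[of _ "sqrt C"]) (use g in auto)
  have A: "A \<in> Cu n" unfolding A_def using b by (simp add: Cu_mult Cu_adj)
  have c: "c \<in> Cu n" unfolding c_def using b G by (simp add: Cu_mult Cu_adj)
  have c_eq: "c = (\<lambda>x y. mat_adj b x y * of_real (sqrt (g y)))"
    unfolding c_def G_def by (rule mult_dg) (use b in \<open>simp add: supp_adj Cu_supp\<close>)
  have GA: "mat_mult G A = (\<lambda>x y. of_real (sqrt (g x)) * A x y)"
    unfolding G_def by (rule dg_mult) (rule Cu_supp[OF A])
  have "mat_mult (mat_adj c) c = mat_mult (mat_mult G A) G"
  proof (intro ext)
    fix x y
    have "mat_mult (mat_adj c) c x y
        = (\<Sum>\<^sub>\<infinity>z. of_real (sqrt (g x)) * (b x z * mat_adj b z y) * of_real (sqrt (g y)))"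
      by (simp add: mat_mult_def c_eq mat_adj_def mult_ac)
    also have "\<dots> = of_real (sqrt (g x)) * A x y * of_real (sqrt (g y))"
      by (simp only: A_def mat_mult_def[of b] infsum_cmult_left' infsum_cmult_right')
    also have "\<dots> = mat_mult (mat_mult G A) G x y"
      using mult_dg[OF Cu_supp[OF Cu_mult[OF G A]], of "\<lambda>x. of_real (sqrt (g x))"]
      by (simp add: GA G_def[symmetric])
    finally show "mat_mult (mat_adj c) c x y = mat_mult (mat_mult G A) G x y" .
  qed
  moreover have "\<phi> (mat_mult (mat_mult G A) G) = \<phi> (mat_mult G (mat_mult G A))"
    using KMS_dg[OF K Cu_mult[OF G A]] G unfolding G_def by blast
  moreover have "mat_mult G (mat_mult G A) = mat_mult (dg n (\<lambda>x. of_real (g x))) A"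
  proof -
    have "mat_mult G (mat_mult G A) = (\<lambda>x y. of_real (sqrt (g x)) * (of_real (sqrt (g x)) * A x y))"
      by (subst (1) G_def, subst dg_mult[OF Cu_supp[OF Cu_mult[OF G A]]]) (simp add: GA)
    then show ?thesis
      using g(1) by (simp add: dg_mult[OF Cu_supp[OF A]] flip: mult.assoc of_real_mult)
  qed
  ultimately show ?thesis
    using state_nonneg[OF KMS_state[OF K] c] by (simp add: A_def)
qed

text \<open>The induction runs on the exact value of the sum, from which the subtracted term is then
  dropped.\<close>

lemma geometric_half_sum_le: "(\<Sum>k=K..<L. (1 / 2 :: real) ^ k) \<le> 2 * (1 / 2) ^ K"
proof -
  have "(\<Sum>k=K..<L. (1 / 2 :: real) ^ k) \<le> 2 * (1 / 2) ^ K - (if K \<le> L then 2 * (1 / 2) ^ L else 0)"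
    by (induction L) (auto simp: sum.atLeastLessThan_Suc le_Suc_eq not_le)
  also have "\<dots> \<le> 2 * (1 / 2) ^ K" by simp
  finally show ?thesis .
qed

text \<open>The states are not assumed continuous, so compact matrices cannot be reached by approximation.
  Instead \<open>a\<close> is factored as \<open>D\<^sup>-\<^sup>1 b\<close> with \<open>b\<close> in the algebra and \<open>D\<close> diagonal tending to infinity;
  since \<open>\<phi>\<close> does not see finite sets of words, \<open>\<phi> (a a\<^sup>*) \<le> K\<^sup>-\<^sup>2 \<phi> (b b\<^sup>*)\<close> for every \<open>K\<close>.\<close>
lemma KMS_compact_zero:
  assumes K: "is_KMS n len \<beta> \<phi>" and root: "\<phi> (pr n {[]}) = 0"
    and a: "a \<in> Cu n" and ca: "compact_mat n a"
  shows "\<phi> a = 0"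
proof -
  note st = KMS_state[OF K]
  have "\<exists>N\<ge>k. sbd (mat_mult (pr n (- lev n N)) a) ((1 / 2) ^ k)" for k
    by (rule compact_mat_tail[OF ca]) simp
  then obtain N where N: "\<And>k. N k \<ge> k" "\<And>k. sbd (mat_mult (pr n (- lev n (N k))) a) ((1 / 2) ^ k)"
    by metis
  \<comment> \<open>\<open>D L x\<close> counts the levels \<open>N k\<close> with
    \<open>k < L\<close> that \<open>x\<close> has passed. On the tree \<open>N k \<ge> k\<close>
    stops the count at the length of \<open>x\<close>, so the limit \<open>E\<close> is finite;
    \<open>E\<close> is the unbounded diagonal, and the \<open>D L\<close> are its bounded
    truncations.\<close>
  define D where "D L x = (\<Sum>k<L. if x \<in> lev n (N k) then 0 else (1 :: real))" for L x
  define E where "E x = D (Suc (length x)) x" for x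
  have DE: "D L x = E x" if "x \<in> Tn n" "length x < L" for L x
    unfolding D_def E_def using that
    by (intro sum.mono_neutral_right) (auto simp: lev_def intro: order.strict_trans2[OF _ N(1)])
  define b where "b = (\<lambda>x y. of_real (E x) * a x y)"
  have Dle: "\<bar>D L x\<bar> \<le> real L" for L x
    unfolding D_def by (rule order_trans[OF sum_abs]) (use sum_bounded_above[of "{..<L}" "\<lambda>k. \<bar>if x \<in> lev n (N k) then 0 else (1 :: real)\<bar>" 1] in auto)
  have DCu: "dg n (\<lambda>x. of_real (D L x)) \<in> Cu n" for L
    by (rule dg_Cu[of _ "real L"]) (use Dle in auto)
  define s where "s L = mat_mult (dg n (\<lambda>x. of_real (D L x))) a" for L
  have s_eq: "s L = (\<lambda>x y. of_real (D L x) * a x y)" for L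
    unfolding s_def by (rule dg_mult[OF Cu_supp[OF a]])
  have sb: "sbd (mat_diff b (s L)) (2 * (1 / 2) ^ L)" for L
  proof (rule sbdI)
    fix S T and f :: "word \<Rightarrow> complex" assume fin: "finite (S::word set)" "finite (T::word set)"
    \<comment> \<open>All words of \<open>S\<close> are shorter than \<open>M\<close>, so on the
      tree rows in \<open>S\<close> the full weight \<open>E\<close> is \<open>D M\<close>. There
      the difference is a finite sum of cut matrices with norms at most
      \<open>(1 / 2) ^ k\<close>.\<close>
    define M where "M = Max (insert L (Suc ` length ` S))"
    have M: "L \<le> M" "\<And>x. x \<in> S \<Longrightarrow> length x < M"
      using fin by (auto simp: M_def Suc_le_eq[symmetric] intro!: Max_ge)
    define m where "m k = mat_mult (pr n (- lev n (N k))) a" for k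
    have "sbd (\<lambda>x y. \<Sum>k\<in>{L..<M}. m k x y) (\<Sum>k\<in>{L..<M}. (1 / 2) ^ k)"
      by (rule sbd_sum) (auto simp: m_def N)
    then have sm: "sbd (\<lambda>x y. \<Sum>k\<in>{L..<M}. m k x y) (2 * (1 / 2) ^ L)"
      using geometric_half_sum_le by (rule sbd_mono)
    have "mat_diff b (s L) x y = (\<Sum>k\<in>{L..<M}. m k x y)" if "x \<in> S" for x y
    proof (cases "x \<in> Tn n")
      case True
      have "(\<Sum>k\<in>{L..<M}. m k x y) = (\<Sum>k\<in>{L..<M}. of_real (if x \<in> lev n (N k) then 0 else 1) * a x y)"
        by (intro sum.cong) (auto simp: m_def pr_mult Cu_supp[OF a])
      also have "\<dots> = of_real (\<Sum>k\<in>{L..<M}. if x \<in> lev n (N k) then 0 else 1) * a x y"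
        by (simp only: of_real_sum sum_distrib_right)
      also have "(\<Sum>k\<in>{L..<M}. if x \<in> lev n (N k) then 0 else 1) = D M x - D L x"
        unfolding D_def using M(1) by (simp add: sum_diff_nat_ivl lessThan_atLeast0 sum.atLeastLessThan_concat[symmetric, of 0 L M])
      finally show ?thesis
        using DE[OF True M(2)[OF that]] by (simp add: mat_diff_def b_def s_eq left_diff_distrib)
    next
      case False
      then have "a x y = 0" using Cu_supp[OF a] by (simp add: supp_def)
      then show ?thesis by (simp add: mat_diff_def b_def s_eq m_def pr_mult Cu_supp[OF a] cong: if_cong)
    qed
    then have "fnorm S (\<lambda>x. \<Sum>y\<in>T. mat_diff b (s L) x y * f y)
        = fnorm S (\<lambda>x. \<Sum>y\<in>T. (\<Sum>k\<in>{L..<M}. m k x y) * f y)"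
      by (intro L2_set_cong) auto
    then show "fnorm S (\<lambda>x. \<Sum>y\<in>T. mat_diff b (s L) x y * f y) \<le> 2 * (1 / 2) ^ L * fnorm T f"
      using sbdD[OF sm fin, of f] by simp
  qed simp
  have b: "b \<in> Cu n"
  proof (rule Cu_closed)
    show "supp n b" using Cu_supp[OF a] by (simp add: supp_def b_def)
    have "s 0 = (\<lambda>x y. 0)" by (simp add: s_eq D_def)
    then show "sbd b 2" using sb[of 0] by (simp add: mat_diff_def)
    fix e :: real assume "e > 0"
    then obtain L where "(1 / 2) ^ L < e / 2" using real_arch_pow_inv[of "e / 2" "1 / 2"] by auto
    then have "2 * (1 / 2) ^ L \<le> e" by simp
    then have "sbd (mat_diff b (s L)) e" by (rule sbd_mono[OF sb])
    moreover have "s L \<in> Cu n" unfolding s_def by (intro Cu_mult DCu a)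
    ultimately show "\<exists>c\<in>Cu n. sbd (mat_diff b c) e" by blast
  qed
  define A where "A = mat_mult a (mat_adj a)"
  define B where "B = mat_mult b (mat_adj b)"
  have A: "A \<in> Cu n" and B: "B \<in> Cu n"
    using a b by (simp_all add: A_def B_def Cu_mult Cu_adj)
  have B_eq: "B x y = of_real (E x) * A x y * of_real (E y)" for x y
  proof -
    have "B x y = (\<Sum>\<^sub>\<infinity>z. of_real (E x) * (a x z * mat_adj a z y) * of_real (E y))"
      by (simp add: B_def mat_mult_def b_def mat_adj_def mult_ac)
    then show ?thesis
      by (simp add: A_def mat_mult_def infsum_cmult_left' infsum_cmult_right')
  qed
  have main: "Re (\<phi> A) * (real k)\<^sup>2 \<le> Re (\<phi> B)" if "k > 0" for k :: nat
  proof -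
    \<comment> \<open>The sum dominates each \<open>N i\<close> with \<open>i < k\<close>, so words
      of the tree outside \<open>L\<close> have passed at least \<open>k\<close> levels and satisfy
      \<open>E x \<ge> k\<close>.\<close>
    define L where "L = lev n (\<Sum>i<k. N i)"
    have large: "real k \<le> E x" if "x \<in> Tn n" "x \<notin> L" for x
    proof -
      have "N i \<le> length x" if "i < k" for i
      proof -
        have "N i \<le> (\<Sum>i<k. N i)" using that by (intro member_le_sum) auto
        then show ?thesis using \<open>x \<in> Tn n\<close> \<open>x \<notin> L\<close> by (simp add: L_def lev_def)
      qed
      then have "D k x = (\<Sum>i<k. 1)"
        unfolding D_def by (intro sum.cong) (auto simp: lev_def dest: leD)
      then have "D k x = real k" by simp
      moreover have "D k x \<le> D (max k (Suc (length x))) x"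
        unfolding D_def by (intro sum_mono2) auto
      ultimately show ?thesis using DE[OF that(1), of "max k (Suc (length x))"] by simp
    qed
    \<comment> \<open>Outside \<open>L\<close> the diagonal \<open>g\<close> undoes the weight
      \<open>E\<close>, so compressing \<open>B\<close> by \<open>G\<close> recovers the compression
      of \<open>A\<close> to the complement of \<open>L\<close>.\<close>
    define g where "g x = (if x \<in> Tn n \<and> x \<notin> L then 1 / E x else 0)" for x
    have g: "0 \<le> g x" "g x \<le> 1 / real k" for x
      using large[of x] \<open>k > 0\<close> by (auto simp: g_def field_simps frac_le)
    define Q where "Q = pr n (- L)"
    define G where "G = dg n (\<lambda>x. of_real (g x))"
    have G: "G \<in> Cu n" unfolding G_def by (rule dg_Cu[of _ "1 / real k"]) (use g in auto)
    have "\<phi> A = \<phi> (mat_mult (pr n L) A) + \<phi> (mat_mult Q A)"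
    proof -
      have "A = mat_add (mat_mult (pr n L) A) (mat_mult Q A)"
        by (auto simp: Q_def pr_mult Cu_supp[OF A] mat_add_def fun_eq_iff)
      then show ?thesis
        using state_add[OF st, of "mat_mult (pr n L) A" "mat_mult Q A"] A by (simp add: Q_def Cu_mult)
    qed
    also have "\<phi> (mat_mult (pr n L) A) = 0"
    proof -
      have "\<phi> (pr n {x}) = 0" if "x \<in> L" for x
        using KMS_pr_word[OF K, of x] that root by (simp add: L_def lev_def)
      then show ?thesis
        using KMS_pr_finite_mult[OF K A, of L] finite_lev by (simp add: L_def lev_def)
    qed
    also have "\<phi> (mat_mult Q A) = \<phi> (mat_mult Q (mat_mult Q A))"
      unfolding Q_def pr_mult[OF Cu_supp[OF Cu_mult[OF pr_Cu A]]]
      by (rule arg_cong[of _ _ \<phi>]) (auto simp: pr_mult Cu_supp[OF A] fun_eq_iff)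
    also have "\<dots> = \<phi> (mat_mult (mat_mult Q A) Q)"
      using KMS_dg[OF K Cu_mult[OF pr_Cu[of n "- L"] A]] pr_Cu[of n "- L"] unfolding Q_def by (simp add: pr_def)
    also have "mat_mult (mat_mult Q A) Q = mat_mult (mat_mult G B) G"
    proof (intro ext)
      fix x y
      have Ex: "E x \<noteq> 0" if "x \<in> Tn n" "x \<notin> L" for x using large[OF that] \<open>k > 0\<close> by auto
      have l: "mat_mult (mat_mult Q A) Q x y = (if x \<notin> L \<and> y \<notin> L then A x y else 0)"
        unfolding Q_def pr_def
        by (simp add: dg_mult_dg[OF Cu_supp[OF A]])
      have "mat_mult (mat_mult G B) G x y = of_real (g x) * B x y * of_real (g y)"
        unfolding G_def
        by (simp add: dg_mult_dg[OF Cu_supp[OF B]])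
      also have "\<dots> = (if x \<notin> L \<and> y \<notin> L then A x y else 0)"
        using Cu_supp[OF A] Ex by (auto simp: g_def B_eq supp_def field_simps)
      finally show "mat_mult (mat_mult Q A) Q x y = mat_mult (mat_mult G B) G x y" using l by simp
    qed
    also have "\<phi> (mat_mult (mat_mult G B) G) = \<phi> (mat_mult G (mat_mult G B))"
      using KMS_dg[OF K Cu_mult[OF G B]] G unfolding G_def by blast
    finally have 1: "\<phi> A = \<phi> (mat_mult G (mat_mult G B))" by simp
    \<comment> \<open>Positivity for the diagonal \<open>1 / k\<^sup>2 - g\<^sup>2\<close> replaces
      a norm estimate and yields the factor \<open>1 / k\<^sup>2\<close> in front of \<phi> at
      \<open>B\<close>.\<close>
    define R where "R = mat_mult (dg n (\<lambda>x. of_real (1 / (real k)\<^sup>2 - (g x)\<^sup>2))) B"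
    have gk: "(g x)\<^sup>2 \<le> 1 / (real k)\<^sup>2" for x
      using power_mono[OF g(2,1), of x 2] by (simp add: power_divide)
    have "0 \<le> Re (\<phi> R)"
      unfolding R_def B_def
      by (rule KMS_dg_nonneg[OF K b, of _ "1 / (real k)\<^sup>2"]) (use gk in auto)
    moreover have "\<phi> (mat_scale (of_real (1 / (real k)\<^sup>2)) B) = \<phi> R + \<phi> (mat_mult G (mat_mult G B))"
    proof -
      have R: "R \<in> Cu n"
        unfolding R_def by (intro Cu_mult B dg_Cu[of _ "1 / (real k)\<^sup>2"]) (use gk in \<open>auto simp: norm_of_real abs_le_iff simp del: of_real_diff of_real_divide\<close>)
      have GGB: "mat_mult G (mat_mult G B) = (\<lambda>x y. of_real (g x) * of_real (g x) * B x y)"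
        unfolding G_def by (rule dg_dg_mult[OF Cu_supp[OF B]])
      have "mat_scale (of_real (1 / (real k)\<^sup>2)) B = mat_add R (mat_mult G (mat_mult G B))"
        unfolding GGB by (auto simp: R_def dg_mult[OF Cu_supp[OF B]] mat_scale_def mat_add_def
            fun_eq_iff algebra_simps power2_eq_square)
      then show ?thesis using state_add[OF st R, of "mat_mult G (mat_mult G B)"] G B by (simp add: Cu_mult)
    qed
    ultimately have "Re (\<phi> A) \<le> Re (\<phi> (mat_scale (of_real (1 / (real k)\<^sup>2)) B))"
      using 1 by simp
    then show ?thesis
      using \<open>k > 0\<close> by (simp add: state_scale[OF st B] field_simps del: of_real_divide of_real_power)
  qed
  have nn: "0 \<le> Re (\<phi> A)"
    using state_nonneg[OF st Cu_adj[OF a]] by (simp add: A_def)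
  have "Re (\<phi> A) = 0"
  proof (rule ccontr)
    assume "Re (\<phi> A) \<noteq> 0"
    then have pos: "Re (\<phi> A) > 0" using nn by simp
    obtain k :: nat where k: "Re (\<phi> B) / Re (\<phi> A) < real k" using reals_Archimedean2 by blast
    have "real (Suc k) \<le> (real (Suc k))\<^sup>2" by (simp add: power2_eq_square)
    then have "Re (\<phi> A) * real (Suc k) \<le> Re (\<phi> B)"
      using main[of "Suc k"] pos by (meson mult_left_mono less_imp_le order_trans zero_less_Suc)
    then show False using k pos by (simp add: field_simps)
  qed
  \<comment> \<open>Cauchy-Schwarz is applied to the identity and the adjoint of \<open>a\<close>,
    since \<open>A\<close> has the adjoint on the right.\<close>
  then have "(cmod (\<phi> (mat_mult a (mat_id n))))\<^sup>2 \<le> 0"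
    using state_cauchy_schwarz[OF st _ Cu_adj[OF a], of "mat_id n"] pr_Cu[of n UNIV]
    by (simp add: A_def mat_id_dg pr_def)
  moreover have "mat_mult a (mat_id n) = a"
    by (simp add: mat_id_dg mult_dg[OF Cu_supp[OF a]])
  ultimately show ?thesis by simp
qed

section \<open>Entire orbits\<close>

lemma Cu_entry_le: "a \<in> Cu n \<Longrightarrow> cmod (a x y) \<le> opnorm n a"
  by (rule sbd_entry[OF Cu_sbd])

lemma entire_ext_diff_Cu:
  assumes "entire_ext n h b F"
  shows "F z \<in> Cu n" "mat_diff (F w) (F z) \<in> Cu n"
  using assms by (auto simp: entire_ext_def Cu_diff)

text \<open>Entries are dominated by \<open>opnorm\<close>, so differentiability in norm makes each
  entry of \<open>F\<close> entire. On the real axis it agrees with the exponential by the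
  definition of \<open>sigma\<close>, and the real axis accumulates at 0.\<close>

lemma entire_ext_entry:
  assumes F: "entire_ext n h b F"
  shows "F z x y = exp (\<i> * z * of_real (h x - h y)) * b x y"
proof -
  let ?g = "\<lambda>z. F z x y - exp (\<i> * z * of_real (h x - h y)) * b x y"
  have "(\<lambda>z. F z x y) holomorphic_on UNIV"
  proof (rule holomorphic_onI)
    fix z
    obtain D where D: "D \<in> Cu n" and lim: "((\<lambda>w. opnorm n (mat_diff (mat_diff (F w) (F z)) (mat_scale (w - z) D))
        / cmod (w - z)) \<longlongrightarrow> 0) (at z)"
      using F unfolding entire_ext_def by blast
    have "((\<lambda>w. (F w x y - F z x y) / (w - z) - D x y) \<longlongrightarrow> 0) (at z)"
    proof (rule Lim_null_comparison[OF _ lim])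
      have "norm ((F w x y - F z x y) / (w - z) - D x y)
          \<le> opnorm n (mat_diff (mat_diff (F w) (F z)) (mat_scale (w - z) D)) / cmod (w - z)"
        if "w \<noteq> z" for w
      proof -
        have "(F w x y - F z x y) / (w - z) - D x y
          = mat_diff (mat_diff (F w) (F z)) (mat_scale (w - z) D) x y / (w - z)"
          using that by (simp add: mat_diff_def mat_scale_def field_simps)
        then show ?thesis
          using Cu_entry_le[OF Cu_diff[OF entire_ext_diff_Cu(2)[OF F] Cu_scale[OF D]]]
          by (simp add: norm_divide divide_right_mono)
      qed
      then show "\<forall>\<^sub>F w in at z. norm ((F w x y - F z x y) / (w - z) - D x y)
          \<le> opnorm n (mat_diff (mat_diff (F w) (F z)) (mat_scale (w - z) D)) / cmod (w - z)"
        by (simp add: eventually_at_filter)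
    qed
    then have "((\<lambda>z. F z x y) has_field_derivative D x y) (at z)"
      unfolding has_field_derivative_iff by (rule LIM_zero_cancel)
    then show "(\<lambda>z. F z x y) field_differentiable at z within UNIV"
      unfolding field_differentiable_def by blast
  qed
  then have "?g holomorphic_on UNIV"
    by (intro holomorphic_intros)
  then have "?g z = 0"
  proof (rule analytic_continuation[where U="range complex_of_real" and \<xi>=0])
    show "(0::complex) islimpt range complex_of_real"
      unfolding islimpt_approachable
    proof (intro allI impI)
      fix e :: real assume "e > 0"
      then show "\<exists>w\<in>range complex_of_real. w \<noteq> 0 \<and> dist w 0 < e"
        by (intro bexI[of _ "of_real (e / 2)"]) (auto simp: dist_norm simp del: of_real_divide)
    qed
    fix w assume "w \<in> range complex_of_real"
    then obtain t where "w = of_real t" by blast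
    then show "?g w = 0"
      using F by (simp add: entire_ext_def sigma_def)
  qed auto
  then show ?thesis by simp
qed

text \<open>At the critical temperature this allows moving the point at which the orbit is
  evaluated, with control in norm and not merely entrywise.\<close>

lemma entire_ext_continuous:
  assumes F: "entire_ext n h b F"
  shows "((\<lambda>w. opnorm n (mat_diff (F w) (F z))) \<longlongrightarrow> 0) (at z)"
proof -
  obtain D where D: "D \<in> Cu n" and lim: "((\<lambda>w. opnorm n (mat_diff (mat_diff (F w) (F z)) (mat_scale (w - z) D))
        / cmod (w - z)) \<longlongrightarrow> 0) (at z)"
    using F unfolding entire_ext_def by blast
  let ?Q = "\<lambda>w. opnorm n (mat_diff (mat_diff (F w) (F z)) (mat_scale (w - z) D)) / cmod (w - z)"
  have "((\<lambda>w. ?Q w * cmod (w - z) + cmod (w - z) * opnorm n D) \<longlongrightarrow> 0 * cmod (z - z) + cmod (z - z) * opnorm n D) (at z)"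
    by (intro tendsto_intros lim)
  then have up: "((\<lambda>w. ?Q w * cmod (w - z) + cmod (w - z) * opnorm n D) \<longlongrightarrow> 0) (at z)"
    by simp
  have "opnorm n (mat_diff (F w) (F z)) \<le> ?Q w * cmod (w - z) + cmod (w - z) * opnorm n D" if "w \<noteq> z" for w
  proof -
    let ?R = "mat_diff (mat_diff (F w) (F z)) (mat_scale (w - z) D)"
    have "mat_diff (F w) (F z) = mat_add ?R (mat_scale (w - z) D)"
      by (simp add: mat_add_def mat_diff_def)
    moreover have "sbd (mat_add ?R (mat_scale (w - z) D)) (opnorm n ?R + cmod (w - z) * opnorm n D)"
      by (intro sbd_add sbd_scale Cu_sbd Cu_diff entire_ext_diff_Cu[OF F] Cu_scale D)
    ultimately show ?thesis
      using opnorm_le[of "mat_diff (F w) (F z)"] that by simp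
  qed
  then have 1: "\<forall>\<^sub>F w in at z. opnorm n (mat_diff (F w) (F z)) \<le> ?Q w * cmod (w - z) + cmod (w - z) * opnorm n D"
    by (simp add: eventually_at_filter)
  have 0: "\<forall>\<^sub>F w in at z. 0 \<le> opnorm n (mat_diff (F w) (F z))"
    using sbd_nonneg[OF Cu_sbd[OF entire_ext_diff_Cu(2)[OF F]]] by simp
  show ?thesis
    by (rule tendsto_sandwich[OF 0 1 tendsto_const up])
qed

section \<open>Gibbs states\<close>

definition gibbs :: "nat \<Rightarrow> real \<Rightarrow> mat \<Rightarrow> complex" where
  "gibbs n \<beta> a = (\<Sum>\<^sub>\<infinity>y\<in>Tn n. a y y * of_real (wt n \<beta> y))"

lemma wt_infsum:
  assumes "\<beta> > ln (real n)" "n \<ge> 1"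
  shows "(\<Sum>\<^sub>\<infinity>y\<in>Tn n. wt n \<beta> y) = 1"
proof -
  have "(\<lambda>N. \<Sum>x\<in>lev n N. wt n \<beta> x) \<longlonglongrightarrow> (\<Sum>\<^sub>\<infinity>y\<in>Tn n. wt n \<beta> y)"
    using assms by (intro filterlim_compose[OF infsum_tendsto lev_tendsto] wt_summable) auto
  moreover have "(\<lambda>N. \<Sum>x\<in>lev n N. wt n \<beta> x) \<longlonglongrightarrow> 1 - 0"
    unfolding sum_wt_lev by (intro tendsto_intros ratio_tendsto assms)
  ultimately show ?thesis using LIMSEQ_unique by fastforce
qed

text \<open>The weights have total mass 1, so the bound is the same for all \<beta> above the
  threshold. This uniformity feeds both the compactness and the limit in the KMS identity.\<close>

lemma gibbs_bound:
  assumes \<beta>: "\<beta> > ln (real n)" and n: "n \<ge> 1" and a: "\<And>y. cmod (a y y) \<le> C"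
  shows "(\<lambda>y. a y y * of_real (wt n \<beta> y)) summable_on Tn n" "cmod (gibbs n \<beta> a) \<le> C"
proof -
  have w: "wt n \<beta> summable_on Tn n" "\<And>y. 0 \<le> wt n \<beta> y"
    using \<beta> n by (auto intro!: wt_summable wt_nonneg)
  have le: "norm (a y y * of_real (wt n \<beta> y)) \<le> C * wt n \<beta> y" for y
    using a w(2) by (simp add: norm_mult mult_right_mono)
  have Cw: "(\<lambda>y. C * wt n \<beta> y) summable_on Tn n"
    by (intro summable_on_cmult_right w)
  have abs: "(\<lambda>y. norm (a y y * of_real (wt n \<beta> y))) summable_on Tn n"
    by (rule Infinite_Sum.abs_summable_on_comparison_test'[OF Cw le])
  then show "(\<lambda>y. a y y * of_real (wt n \<beta> y)) summable_on Tn n"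
    by (rule abs_summable_summable)
  have "cmod (gibbs n \<beta> a) \<le> (\<Sum>\<^sub>\<infinity>y\<in>Tn n. norm (a y y * of_real (wt n \<beta> y)))"
    unfolding gibbs_def by (rule norm_infsum_bound[OF abs])
  also have "\<dots> \<le> (\<Sum>\<^sub>\<infinity>y\<in>Tn n. C * wt n \<beta> y)"
    by (rule infsum_mono[OF abs Cw le])
  also have "\<dots> = C"
    by (simp add: infsum_cmult_right' wt_infsum[OF \<beta> n])
  finally show "cmod (gibbs n \<beta> a) \<le> C" .
qed

lemma gibbs_add:
  assumes "\<beta> > ln (real n)" "n \<ge> 1" "\<And>y. cmod (a y y) \<le> C" "\<And>y. cmod (b y y) \<le> D"
  shows "gibbs n \<beta> (mat_add a b) = gibbs n \<beta> a + gibbs n \<beta> b"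
  unfolding gibbs_def mat_add_def distrib_right
  using assms by (intro infsum_add gibbs_bound) auto

lemma gibbs_scale: "gibbs n \<beta> (mat_scale c a) = c * gibbs n \<beta> a"
  by (simp add: gibbs_def mat_scale_def mult.assoc infsum_cmult_right')

lemma infsum_of_real_complex:
  assumes "f summable_on A"
  shows "(\<Sum>\<^sub>\<infinity>x\<in>A. complex_of_real (f x)) = of_real (infsum f A)"
  by (rule infsumI) (rule has_sum_of_real[OF has_sum_infsum[OF assms]])

lemma mat_adj_mult_diag:
  assumes "sbd a C"
  shows "mat_mult (mat_adj a) a y y = of_real ((ell2norm (\<lambda>x. a x y))\<^sup>2)"
proof -
  have sm: "(\<lambda>x. (cmod (a x y))\<^sup>2) summable_on UNIV"
    using sbd_col(1)[OF assms] by (simp add: l2_def)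
  have "mat_mult (mat_adj a) a y y = (\<Sum>\<^sub>\<infinity>x. complex_of_real ((cmod (a x y))\<^sup>2))"
    unfolding mat_mult_def mat_adj_def by (simp add: complex_norm_square mult.commute del: of_real_power)
  then show ?thesis
    unfolding infsum_of_real_complex[OF sm] by (simp add: ell2norm_def infsum_nonneg)
qed

lemma gibbs_nonneg:
  assumes \<beta>: "\<beta> > ln (real n)" and n: "n \<ge> 1" and a: "sbd a C"
  shows "gibbs n \<beta> (mat_mult (mat_adj a) a) \<in> \<real>" "0 \<le> Re (gibbs n \<beta> (mat_mult (mat_adj a) a))"
proof -
  have bd: "cmod (mat_mult (mat_adj a) a y y) \<le> C * C" for y
    by (rule sbd_entry[OF sbd_mult[OF sbd_adj[OF a] a]])
  let ?f = "\<lambda>y. (ell2norm (\<lambda>x. a x y))\<^sup>2 * wt n \<beta> y"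
  have eq: "mat_mult (mat_adj a) a y y * of_real (wt n \<beta> y) = of_real (?f y)" for y
    by (simp add: mat_adj_mult_diag[OF a])
  have "(\<lambda>y. complex_of_real (?f y)) summable_on Tn n"
    using gibbs_bound(1)[of n \<beta> "mat_mult (mat_adj a) a", OF \<beta> n bd] unfolding eq .
  moreover have "norm (complex_of_real (?f y)) = ?f y" for y
    using wt_nonneg[of n \<beta> y] \<beta> n by (simp only: norm_of_real abs_of_nonneg mult_nonneg_nonneg zero_le_power2)
  ultimately have "?f summable_on Tn n"
    unfolding summable_on_iff_abs_summable_on_complex by simp
  then have "gibbs n \<beta> (mat_mult (mat_adj a) a) = of_real (infsum ?f (Tn n))"
    unfolding gibbs_def eq by (rule infsum_of_real_complex)
  moreover have "infsum ?f (Tn n) \<ge> 0"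
    using wt_nonneg[of n \<beta>] \<beta> n by (intro infsum_nonneg mult_nonneg_nonneg) auto
  ultimately show "gibbs n \<beta> (mat_mult (mat_adj a) a) \<in> \<real>" "0 \<le> Re (gibbs n \<beta> (mat_mult (mat_adj a) a))"
    by auto
qed

lemma gibbs_state:
  assumes \<beta>: "\<beta> > ln (real n)" and n: "n \<ge> 1"
  shows "is_state n (gibbs n \<beta>)"
  unfolding is_state_def
proof (intro conjI ballI allI)
  show "gibbs n \<beta> (mat_id n) = 1"
  proof -
    have "gibbs n \<beta> (mat_id n) = (\<Sum>\<^sub>\<infinity>y\<in>Tn n. complex_of_real (wt n \<beta> y))"
      unfolding gibbs_def by (rule infsum_cong) (simp add: mat_id_def)
    then show ?thesis
      using infsum_of_real_complex[OF wt_summable[of n \<beta>]] \<beta> n by (simp add: wt_infsum[OF \<beta> n])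
  qed
  fix a assume a: "a \<in> Cu n"
  show "gibbs n \<beta> (mat_add a b) = gibbs n \<beta> a + gibbs n \<beta> b" if "b \<in> Cu n" for b
    by (rule gibbs_add[OF \<beta> n Cu_entry_le[OF a] Cu_entry_le[OF that]])
qed (auto simp: gibbs_scale gibbs_nonneg[OF \<beta> n Cu_sbd])

text \<open>The factor of the entry \<open>x y\<close> of the orbit at \<open>\<i> * \<beta>\<close>
  converts the weight of \<open>y\<close> into that of \<open>x\<close>. Both sides are then the
  same double sum of \<open>T\<close> in opposite orders.\<close>

lemma gibbs_KMS:
  assumes \<beta>: "\<beta> > ln (real n)" and n: "n \<ge> 1"
  shows "is_KMS n len \<beta> (gibbs n \<beta>)"
  unfolding is_KMS_def
proof (intro conjI ballI allI impI gibbs_state assms)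
  fix a b F assume a: "a \<in> Cu n" and b: "b \<in> Cu n" and F: "entire_ext n len b F"
  define T where "T x y = a y x * b x y * of_real (wt n \<beta> x)" for x y
  have T0: "T x y = 0" if "x \<notin> Tn n \<or> y \<notin> Tn n" for x y
    using that Cu_supp[OF a] by (auto simp: T_def supp_def)
  have wt: "exp (\<i> * (\<i> * of_real \<beta>) * of_real (len x - len y)) * of_real (wt n \<beta> y) = complex_of_real (wt n \<beta> x)" for x y
  proof -
    have "\<i> * (\<i> * of_real \<beta>) * of_real (len x - len y) = complex_of_real (- \<beta> * (len x - len y))"
      by (simp flip: mult.assoc)
    moreover have "exp (- \<beta> * (len x - len y)) * wt n \<beta> y = wt n \<beta> x"
      by (simp add: wt_eq algebra_simps flip: exp_add mult.assoc)
    ultimately show ?thesis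
      by (metis exp_of_real of_real_mult)
  qed
  have 1: "gibbs n \<beta> (mat_mult a (F (\<i> * of_real \<beta>))) = (\<Sum>\<^sub>\<infinity>y\<in>Tn n. \<Sum>\<^sub>\<infinity>x\<in>Tn n. T x y)"
    unfolding gibbs_def
  proof (rule infsum_cong)
    fix y
    have "a y x * F (\<i> * of_real \<beta>) x y * of_real (wt n \<beta> y) = T x y" for x
      unfolding T_def wt[of x y, symmetric] entire_ext_entry[OF F] by (simp add: mult_ac)
    then have "mat_mult a (F (\<i> * of_real \<beta>)) y y * of_real (wt n \<beta> y) = (\<Sum>\<^sub>\<infinity>x. T x y)"
      by (simp add: mat_mult_def flip: infsum_cmult_left')
    also have "\<dots> = (\<Sum>\<^sub>\<infinity>x\<in>Tn n. T x y)"
      by (rule infsum_cong_neutral) (use T0 in auto)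
    finally show "mat_mult a (F (\<i> * of_real \<beta>)) y y * of_real (wt n \<beta> y) = (\<Sum>\<^sub>\<infinity>x\<in>Tn n. T x y)" .
  qed
  have 2: "gibbs n \<beta> (mat_mult b a) = (\<Sum>\<^sub>\<infinity>x\<in>Tn n. \<Sum>\<^sub>\<infinity>y\<in>Tn n. T x y)"
    unfolding gibbs_def
  proof (rule infsum_cong)
    fix x
    have "mat_mult b a x x * of_real (wt n \<beta> x) = (\<Sum>\<^sub>\<infinity>y. b x y * a y x * of_real (wt n \<beta> x))"
      unfolding mat_mult_def by (rule infsum_cmult_left'[symmetric])
    also have "\<dots> = (\<Sum>\<^sub>\<infinity>y. T x y)"
      by (intro infsum_cong) (simp add: T_def)
    also have "\<dots> = (\<Sum>\<^sub>\<infinity>y\<in>Tn n. T x y)"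
      by (rule infsum_cong_neutral) (use T0 in auto)
    finally show "mat_mult b a x x * of_real (wt n \<beta> x) = (\<Sum>\<^sub>\<infinity>y\<in>Tn n. T x y)" .
  qed
  have w0: "0 \<le> wt n \<beta> x" for x using \<beta> n by (intro wt_nonneg) auto
  have nT: "norm (T x y) = cmod (b x y * a y x) * wt n \<beta> x" for x y
    using w0 by (simp add: T_def norm_mult)
  have row: "(\<lambda>y. cmod (b x y * a y x)) summable_on UNIV"
      "(\<Sum>\<^sub>\<infinity>y. cmod (b x y * a y x)) \<le> opnorm n b * opnorm n a" for x
  proof -
    note l2 = sbd_row[OF Cu_sbd[OF b], of x] sbd_col[OF Cu_sbd[OF a], of x]
    show "(\<lambda>y. cmod (b x y * a y x)) summable_on UNIV"
      by (rule l2_cauchy_schwarz(1)[OF l2(1,3)])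
    have "(\<Sum>\<^sub>\<infinity>y. cmod (b x y * a y x)) \<le> ell2norm (b x) * ell2norm (\<lambda>y. a y x)"
      by (rule l2_cauchy_schwarz(2)[OF l2(1,3)])
    also have "\<dots> \<le> opnorm n b * opnorm n a"
      using l2 by (intro mult_mono ell2norm_nonneg sbd_nonneg[OF Cu_sbd[OF b]])
    finally show "(\<Sum>\<^sub>\<infinity>y. cmod (b x y * a y x)) \<le> opnorm n b * opnorm n a" .
  qed
  \<comment> \<open>Absolute summability for Fubini: for fixed \<open>x\<close>, Cauchy-Schwarz for
    a row of \<open>b\<close> and a column of \<open>a\<close> bounds the inner sum by a constant
    times the summable weight of \<open>x\<close>.\<close>
  have "(\<lambda>(x, y). norm (T x y)) summable_on (Tn n \<times> Tn n)"
  proof (rule summable_on_SigmaI)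
    show "((\<lambda>y. case (x, y) of (x, y) \<Rightarrow> norm (T x y)) has_sum (\<Sum>\<^sub>\<infinity>y\<in>Tn n. norm (T x y))) (Tn n)" for x
      unfolding nT prod.case
      by (intro has_sum_infsum summable_on_cmult_left summable_on_subset_banach[OF row(1)]) auto
    show "(\<lambda>x. \<Sum>\<^sub>\<infinity>y\<in>Tn n. norm (T x y)) summable_on Tn n"
    proof (rule summable_on_comparison_test)
      show "(\<lambda>x. opnorm n b * opnorm n a * wt n \<beta> x) summable_on Tn n"
        using \<beta> n by (intro summable_on_cmult_right wt_summable) auto
      show "(\<Sum>\<^sub>\<infinity>y\<in>Tn n. norm (T x y)) \<le> opnorm n b * opnorm n a * wt n \<beta> x" for x
      proof -
        have "(\<Sum>\<^sub>\<infinity>y\<in>Tn n. norm (T x y)) = (\<Sum>\<^sub>\<infinity>y\<in>Tn n. cmod (b x y * a y x)) * wt n \<beta> x"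
          unfolding nT by (rule infsum_cmult_left')
        also have "(\<Sum>\<^sub>\<infinity>y\<in>Tn n. cmod (b x y * a y x)) \<le> (\<Sum>\<^sub>\<infinity>y. cmod (b x y * a y x))"
          by (intro infsum_mono_neutral summable_on_subset_banach[OF row(1)] row(1)) auto
        also note row(2)
        finally show ?thesis using w0 by (simp add: mult_right_mono)
      qed
      show "0 \<le> (\<Sum>\<^sub>\<infinity>y\<in>Tn n. norm (T x y))" for x by (intro infsum_nonneg) auto
    qed
  qed auto
  then have "(\<lambda>p. norm (case p of (x, y) \<Rightarrow> T x y)) summable_on (Tn n \<times> Tn n)"
    by (simp add: case_prod_unfold)
  then have "(\<lambda>(x, y). T x y) summable_on (Tn n \<times> Tn n)"
    by (rule abs_summable_summable)
  from infsum_swap_banach[OF this]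
  show "gibbs n \<beta> (mat_mult a (F (\<i> * of_real \<beta>))) = gibbs n \<beta> (mat_mult b a)"
    unfolding 1 2 by simp
qed

section \<open>The critical temperature\<close>

text \<open>Linearity, reality, positivity and normalisation are closed conditions on finitely many
  values, so they survive pointwise limits. The KMS identity needs an extra argument because the
  point at which \<open>F\<close> is evaluated moves with the temperature.\<close>

lemma KMS_critical_exists:
  assumes n: "n \<ge> 1"
  shows "\<exists>\<phi>. is_KMS n len (ln (real n)) \<phi>"
proof -
  define \<beta> where "\<beta> = ln (real n)"
  \<comment> \<open>Strictly above the threshold the Gibbs states exist, and the points differ from
    \<beta>, as the punctured limit in \<open>entire_ext_continuous\<close> requires.\<close>
  define \<beta>k where "\<beta>k k = \<beta> + 1 / real (Suc k)" for k
  have \<beta>k: "\<beta>k k > ln (real n)" for k by (simp add: \<beta>k_def \<beta>_def)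
  \<comment> \<open>The product of discs is indexed by all matrices, so a radius is needed even
    outside \<open>Cu n\<close>. Where the diagonal is unbounded, \<psi> is set to 0.\<close>
  define R where "R a = (if \<exists>C. \<forall>y::word. cmod (a y y) \<le> C then SOME C. \<forall>y::word. cmod (a y y) \<le> C else 0)" for a :: mat
  define \<psi> where "\<psi> k a = (if \<exists>C. \<forall>y::word. cmod (a y y) \<le> C then gibbs n (\<beta>k k) a else 0)" for k and a :: mat
  have \<psi>: "\<psi> k a = gibbs n (\<beta>k k) a" if "sbd a C" for k a C
  proof -
    have "\<exists>C. \<forall>y. cmod (a y y) \<le> C" using sbd_entry[OF that] by blast
    then show ?thesis by (simp add: \<psi>_def)
  qed
  define S where "S = PiE UNIV (\<lambda>a. cball (0::complex) (R a))"
  have "compactin (product_topology (\<lambda>_. euclidean) UNIV) S"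
    unfolding S_def compactin_PiE by auto
  then have "compact S"
    by (simp add: euclidean_product_topology)
  have "\<psi> k \<in> S" for k
  proof -
    have "cmod (\<psi> k a) \<le> R a" for a
    proof (cases "\<exists>C. \<forall>y::word. cmod (a y y) \<le> C")
      case True
      then have "\<forall>y. cmod (a y y) \<le> R a" using someI_ex[OF True] by (simp add: R_def)
      then show ?thesis using gibbs_bound(2)[OF \<beta>k n, of a "R a"] True by (simp add: \<psi>_def)
    next
      case False
      show ?thesis unfolding \<psi>_def R_def if_not_P[OF False] by simp
    qed
    then show ?thesis by (simp add: S_def PiE_UNIV_domain)
  qed
  then have "\<forall>\<^sub>F \<psi>' in filtermap \<psi> sequentially. \<psi>' \<in> S"
    by (simp add: eventually_filtermap)
  \<comment> \<open>The product has one factor per matrix, so compactness is used through a cluster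
    point instead of a convergent subsequence; limits are then taken along the filter
    \<open>G\<close>.\<close>
  then obtain \<phi> where bot: "inf (nhds \<phi>) (filtermap \<psi> sequentially) \<noteq> bot"
    using \<open>compact S\<close> unfolding compact_filter
    by (metis filtermap_bot_iff trivial_limit_sequentially)
  define G where "G = inf (nhds \<phi>) (filtermap \<psi> sequentially)"
  have G: "G \<noteq> bot" using bot by (simp add: G_def)
  have ev: "eventually P G" if "\<And>k. P (\<psi> k)" for P
    unfolding G_def using that
    by (intro filter_leD[OF inf_le2]) (simp add: eventually_filtermap)
  have lim: "((\<lambda>\<psi>'. \<psi>' a) \<longlongrightarrow> \<phi> a) G" for a
  proof (rule tendsto_mono)
    show "G \<le> nhds \<phi>" by (simp add: G_def)
    show "((\<lambda>\<psi>'. \<psi>' a) \<longlongrightarrow> \<phi> a) (nhds \<phi>)"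
    proof (rule topological_tendstoI)
      fix U assume U: "open U" "\<phi> a \<in> U"
      then have "open ((\<lambda>\<psi>'. \<psi>' a) -` U)"
        by (intro open_vimage continuous_on_product_coordinates)
      then show "\<forall>\<^sub>F \<psi>' in nhds \<phi>. \<psi>' a \<in> U"
        using U(2) unfolding eventually_nhds by blast
    qed
  qed
  have limk: "((\<lambda>\<psi>'. f \<psi>') \<longlongrightarrow> 0) G" if "(\<lambda>k. f (\<psi> k)) \<longlonglongrightarrow> 0" for f :: "(mat \<Rightarrow> complex) \<Rightarrow> complex"
    by (rule tendsto_mono[of _ "filtermap \<psi> sequentially"])
       (use that in \<open>auto simp: G_def filterlim_filtermap\<close>)
  have "is_state n \<phi>"
    unfolding is_state_def
  proof (intro conjI ballI allI)
    fix a b assume ab: "a \<in> Cu n" "b \<in> Cu n"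
    have "\<forall>\<^sub>F \<psi>' in G. \<psi>' a + \<psi>' b = \<psi>' (mat_add a b)"
      by (rule ev) (simp add: \<psi>[OF Cu_sbd[OF ab(1)]] \<psi>[OF Cu_sbd[OF ab(2)]] \<psi>[OF Cu_sbd[OF Cu_add[OF ab]]]
          gibbs_add[OF \<beta>k n Cu_entry_le[OF ab(1)] Cu_entry_le[OF ab(2)]])
    then have "((\<lambda>\<psi>'. \<psi>' (mat_add a b)) \<longlongrightarrow> \<phi> a + \<phi> b) G"
      by (rule Lim_transform_eventually[OF tendsto_add[OF lim lim]])
    then show "\<phi> (mat_add a b) = \<phi> a + \<phi> b"
      by (rule tendsto_unique[OF G lim])
  next
    fix a c assume a: "a \<in> Cu n"
    have "\<forall>\<^sub>F \<psi>' in G. c * \<psi>' a = \<psi>' (mat_scale c a)"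
      by (rule ev) (simp add: \<psi>[OF Cu_sbd[OF a]] \<psi>[OF Cu_sbd[OF Cu_scale[OF a]]] gibbs_scale)
    then have "((\<lambda>\<psi>'. \<psi>' (mat_scale c a)) \<longlongrightarrow> c * \<phi> a) G"
      by (rule Lim_transform_eventually[OF tendsto_mult_left[OF lim]])
    then show "\<phi> (mat_scale c a) = c * \<phi> a"
      by (rule tendsto_unique[OF G lim])
  next
    fix a assume a: "a \<in> Cu n"
    let ?p = "mat_mult (mat_adj a) a"
    have p: "\<psi> k ?p = gibbs n (\<beta>k k) ?p" for k
      by (rule \<psi>[OF Cu_sbd[OF Cu_mult[OF Cu_adj[OF a] a]]])
    have "\<forall>\<^sub>F \<psi>' in G. \<psi>' ?p \<in> \<real>"
      by (rule ev) (simp add: p gibbs_nonneg(1)[OF \<beta>k n Cu_sbd[OF a]])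
    then show "\<phi> ?p \<in> \<real>"
      by (rule Lim_in_closed_set[OF closed_complex_Reals _ G lim])
    have "\<forall>\<^sub>F \<psi>' in G. 0 \<le> Re (\<psi>' ?p)"
      by (rule ev) (simp add: p gibbs_nonneg(2)[OF \<beta>k n Cu_sbd[OF a]])
    then show "0 \<le> Re (\<phi> ?p)"
      by (rule tendsto_lowerbound[OF tendsto_Re[OF lim] _ G])
  next
    have "\<forall>\<^sub>F \<psi>' in G. 1 = \<psi>' (mat_id n)"
      by (rule ev) (use \<psi>[OF Cu_sbd[OF pr_Cu[of n UNIV]]] state_id[OF gibbs_state[OF \<beta>k n]] in \<open>simp add: pr_def mat_id_dg\<close>)
    then have "((\<lambda>\<psi>'. \<psi>' (mat_id n)) \<longlongrightarrow> 1) G"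
      by (rule Lim_transform_eventually[OF tendsto_const])
    then show "\<phi> (mat_id n) = 1"
      by (rule tendsto_unique[OF G lim])
  qed
  moreover have "\<phi> (mat_mult a (F (\<i> * of_real \<beta>))) = \<phi> (mat_mult b a)"
    if a: "a \<in> Cu n" and b: "b \<in> Cu n" and F: "entire_ext n len b F" for a b F
  proof -
    let ?z = "\<lambda>\<beta>. \<i> * complex_of_real \<beta>"
    note Fc = entire_ext_diff_Cu[OF F]
    \<comment> \<open>The functional \<open>\<psi> k\<close> satisfies the identity with
      \<open>F\<close> at its own temperature; \<open>d k\<close> is the error of evaluating
      \<open>F\<close> at \<beta> instead, and \<open>gibbs_bound\<close> makes its contribution
      vanish.\<close>
    define d where "d k = mat_diff (F (?z (\<beta>k k))) (F (?z \<beta>))" for k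
    have d: "d k \<in> Cu n" for k by (simp add: d_def Fc)
    have "(\<lambda>k. opnorm n (d k)) \<longlonglongrightarrow> 0"
      unfolding d_def
    proof (rule filterlim_compose[OF entire_ext_continuous[OF F]])
      have "(\<lambda>k. ?z (\<beta>k k)) \<longlonglongrightarrow> ?z (\<beta> + 0)"
        unfolding \<beta>k_def using LIMSEQ_inverse_real_of_nat
        by (intro tendsto_intros) (simp add: inverse_eq_divide)
      moreover have "?z (\<beta>k k) \<noteq> ?z \<beta>" for k
        using \<beta>k[of k] by (simp add: \<beta>_def)
      ultimately show "filterlim (\<lambda>k. ?z (\<beta>k k)) (at (?z \<beta>)) sequentially"
        by (simp add: filterlim_at)
    qed
    then have up: "(\<lambda>k. opnorm n a * opnorm n (d k)) \<longlonglongrightarrow> 0"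
      by (rule tendsto_mult_right_zero)
    have "(\<lambda>k. \<psi> k (mat_mult b a) - \<psi> k (mat_mult a (F (?z \<beta>)))) \<longlonglongrightarrow> 0"
    proof (rule Lim_null_comparison[OF always_eventually up], rule allI)
      fix k
      have eq: "mat_mult a (F (?z (\<beta>k k))) = mat_add (mat_mult a (d k)) (mat_mult a (F (?z \<beta>)))"
        using mat_mult_add_right[OF Cu_sbd[OF d[of k]] Cu_sbd[OF Fc(1)[of "?z \<beta>"]] Cu_sbd[OF a]]
        by (simp add: d_def mat_add_def mat_diff_def)
      have "\<psi> k (mat_mult b a) = gibbs n (\<beta>k k) (mat_mult b a)"
        by (rule \<psi>[OF Cu_sbd[OF Cu_mult[OF b a]]])
      also have "\<dots> = gibbs n (\<beta>k k) (mat_mult a (F (?z (\<beta>k k))))"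
        using gibbs_KMS[OF \<beta>k n, of k] a b F unfolding is_KMS_def by simp
      also have "\<dots> = gibbs n (\<beta>k k) (mat_mult a (d k)) + gibbs n (\<beta>k k) (mat_mult a (F (?z \<beta>)))"
        unfolding eq by (rule gibbs_add[OF \<beta>k n Cu_entry_le[OF Cu_mult[OF a d]] Cu_entry_le[OF Cu_mult[OF a Fc(1)]]])
      also have "gibbs n (\<beta>k k) (mat_mult a (F (?z \<beta>))) = \<psi> k (mat_mult a (F (?z \<beta>)))"
        by (rule \<psi>[OF Cu_sbd[OF Cu_mult[OF a Fc(1)]], symmetric])
      finally have "\<psi> k (mat_mult b a) - \<psi> k (mat_mult a (F (?z \<beta>))) = gibbs n (\<beta>k k) (mat_mult a (d k))"
        by simp
      then show "norm (\<psi> k (mat_mult b a) - \<psi> k (mat_mult a (F (?z \<beta>)))) \<le> opnorm n a * opnorm n (d k)"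
        using gibbs_bound(2)[OF \<beta>k n sbd_entry[OF sbd_mult[OF Cu_sbd[OF a] Cu_sbd[OF d]]]] by simp
    qed
    then have "((\<lambda>\<psi>'. \<psi>' (mat_mult b a) - \<psi>' (mat_mult a (F (?z \<beta>)))) \<longlongrightarrow> 0) G"
      by (rule limk)
    then have "\<phi> (mat_mult b a) - \<phi> (mat_mult a (F (?z \<beta>))) = 0"
      using tendsto_unique[OF G tendsto_diff[OF lim lim]] by blast
    then show ?thesis by simp
  qed
  ultimately show ?thesis
    unfolding is_KMS_def \<beta>_def by blast
qed

theorem theorem5p4:
  fixes n :: nat and \<beta> :: real
  assumes "n \<ge> 1"
  defines "h \<equiv> (\<lambda>x::word. real (length x))"
  shows "((\<exists>\<phi>. is_KMS n h \<beta> \<phi>) \<longleftrightarrow> \<beta> \<ge> ln (real n)) \<and>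
    (\<beta> > ln (real n) \<longrightarrow>
       (\<exists>\<phi>. is_KMS n h \<beta> \<phi>) \<and>
       (\<forall>\<phi>. is_KMS n h \<beta> \<phi> \<longrightarrow> (\<forall>a \<in> Cu n.
          \<phi> a = (\<Sum>\<^sub>\<infinity>y\<in>Tn n. a y y *
                  complex_of_real (exp (- \<beta> * real (length y))
                                   - real n * exp (- \<beta> * (real (length y) + 1))))))) \<and>
    (\<beta> = ln (real n) \<longrightarrow>
       (\<forall>\<phi>. is_KMS n h \<beta> \<phi> \<longrightarrow> (\<forall>a \<in> Cu n. compact_mat n a \<longrightarrow> \<phi> a = 0)))"
proof (intro conjI impI allI ballI)
  have ex: "\<exists>\<phi>. is_KMS n h \<beta> \<phi>" if "\<beta> > ln (real n)"
    using gibbs_KMS[OF that assms(1)] unfolding h_def by blast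
  then show "\<beta> > ln (real n) \<Longrightarrow> \<exists>\<phi>. is_KMS n h \<beta> \<phi>" .
  show "(\<exists>\<phi>. is_KMS n h \<beta> \<phi>) \<longleftrightarrow> \<beta> \<ge> ln (real n)"
    using ex KMS_critical_exists[OF assms(1)] KMS_ge_ln[OF _ assms(1)] unfolding h_def
    by (metis less_eq_real_def)
next
  fix \<phi> a assume "\<beta> > ln (real n)" "is_KMS n h \<beta> \<phi>" "a \<in> Cu n"
  then show "\<phi> a = (\<Sum>\<^sub>\<infinity>y\<in>Tn n. a y y *
      complex_of_real (exp (- \<beta> * real (length y)) - real n * exp (- \<beta> * (real (length y) + 1))))"
    using KMS_formula[OF _ assms(1)] unfolding h_def wt_def by blast
next
  fix \<phi> a assume \<beta>: "\<beta> = ln (real n)" and K: "is_KMS n h \<beta> \<phi>" and a: "a \<in> Cu n" "compact_mat n a"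
  have "real n * exp (- \<beta>) = 1"
    using assms(1) by (simp add: \<beta> exp_minus)
  then have "\<phi> (pr n {[]}) = 0"
    using KMS_pr_root[of n \<beta> \<phi>] K by (simp add: h_def del: of_real_mult of_real_diff)
  then show "\<phi> a = 0"
    using KMS_compact_zero[of n \<beta> \<phi> a] K a by (simp add: h_def)
qed

end
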